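(* Let $k\ge2$. Algorithm 1 run with sample size $pn=\frac{n}{e}$ and with $\mathcal{A}$ being the greedy algorithm is $$\frac{1+\frac{1}{2e^3}-\frac{3}{2e}-\frac{e-1}{e^2k}}{e-1}\left(1-\frac{\sqrt{k-1}}{(k+1)\sqrt{2\pi}}\right)\text{-competitive}$$ for the submodular secretary problem.
   Context: Submodular secretary setting. Let $U$ be a finite ground set of $n$ items and $k\ge1$ an integer. Let $v\colon 2^U\to\mathbb{R}_{\ge0}$ be monotone and submodular, and $\mathrm{OPT}\in\arg\max\{v(S): S\subseteq U, |S|\le k\}$. The items arrive one per round (rounds $1,\dots,n$) in a uniformly random order; $U^{\le \ell}$ denotes the set of items arriving in rounds $1,\dots,\ell$. The greedy algorithm, given $L\subseteq U$, starts from $\emptyset$ and repeatedly adds an item of $L$ with maximum marginal increase $v(S\cup\{x\})-v(S)$ (ties broken by a fixed rule depending only on the items) until $\min(k,|L|)$ items are chosen; $\mathcal{A}(L)$ denotes its output. Algorithm 1 with sample size $pn$: it rejects the items arriving in rounds $1,\dots,\lceil pn\rceil-1$; in each round $\ell\ge\lceil pn\rceil$, with arriving item $j$, it computes $S^{(\ell)}=\mathcal{A}(U^{\le\ell})$; if $j\in S^{(\ell)}$ and fewer than $k$ items have been accepted so far, $j$ is accepted, otherwise rejected. $\mathrm{ALG}$ denotes the set of accepted items. An algorithm is $c$-competitive if for every such $v$, $\mathbb{E}[v(\mathrm{ALG})]\ge (c-o(1))\,v(\mathrm{OPT})$, with $o(1)\to0$ as $n\to\infty$. *)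

theory Defs
  imports "HOL-Probability.Probability" "HOL-Combinatorics.Multiset_Permutations"
begin

definition monotone_setfun :: "'a set \<Rightarrow> ('a set \<Rightarrow> real) \<Rightarrow> bool" where
  "monotone_setfun U v \<longleftrightarrow> (\<forall>S T. S \<subseteq> T \<and> T \<subseteq> U \<longrightarrow> v S \<le> v T)"

definition submodular_setfun :: "'a set \<Rightarrow> ('a set \<Rightarrow> real) \<Rightarrow> bool" where
  "submodular_setfun U v \<longleftrightarrow>
     (\<forall>A B. A \<subseteq> U \<and> B \<subseteq> U \<longrightarrow> v (A \<union> B) + v (A \<inter> B) \<le> v A + v B)"

definition nonneg_setfun :: "'a set \<Rightarrow> ('a set \<Rightarrow> real) \<Rightarrow> bool" where
  "nonneg_setfun U v \<longleftrightarrow> (\<forall>S. S \<subseteq> U \<longrightarrow> 0 \<le> v S)"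

definition opt_value :: "'a set \<Rightarrow> ('a set \<Rightarrow> real) \<Rightarrow> nat \<Rightarrow> real" where
  "opt_value U v k = Max {v S | S. S \<subseteq> U \<and> card S \<le> k}"

definition tie_rule :: "('a set \<Rightarrow> 'a) \<Rightarrow> bool" where
  "tie_rule tb \<longleftrightarrow> (\<forall>T. T \<noteq> {} \<longrightarrow> tb T \<in> T)"

definition greedy_step :: "('a set \<Rightarrow> real) \<Rightarrow> ('a set \<Rightarrow> 'a) \<Rightarrow> 'a set \<Rightarrow> 'a set \<Rightarrow> 'a set" where
  "greedy_step v tb L S =
     insert (tb {x \<in> L - S. \<forall>y \<in> L - S. v (insert y S) - v S \<le> v (insert x S) - v S}) S"

definition greedy :: "('a set \<Rightarrow> real) \<Rightarrow> ('a set \<Rightarrow> 'a) \<Rightarrow> nat \<Rightarrow> 'a set \<Rightarrow> 'a set" where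
  "greedy v tb k L = (greedy_step v tb L ^^ min k (card L)) {}"

text \<open>Round l (1-indexed) of Algorithm 1 for arrival order xs (xs ! (l-1) arrives
  in round l); A is the set of items accepted so far.\<close>
definition alg1_round :: "('a set \<Rightarrow> real) \<Rightarrow> ('a set \<Rightarrow> 'a) \<Rightarrow> nat \<Rightarrow> 'a list \<Rightarrow> 'a set \<Rightarrow> nat \<Rightarrow> 'a set" where
  "alg1_round v tb k xs A l =
     (let j = xs ! (l - 1) in
      if j \<in> greedy v tb k (set (take l xs)) \<and> card A < k then insert j A else A)"

text \<open>Algorithm 1 with sample size p*n: rounds 1..ceil(pn)-1 are rejected, rounds
  ceil(pn)..n are processed.\<close>
definition alg1 :: "real \<Rightarrow> ('a set \<Rightarrow> real) \<Rightarrow> ('a set \<Rightarrow> 'a) \<Rightarrow> nat \<Rightarrow> 'a list \<Rightarrow> 'a set" where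
  "alg1 p v tb k xs =
     foldl (alg1_round v tb k xs) {}
       [max 1 (nat \<lceil>p * real (length xs)\<rceil>) ..< Suc (length xs)]"

definition expected_alg1 :: "real \<Rightarrow> 'a set \<Rightarrow> ('a set \<Rightarrow> real) \<Rightarrow> ('a set \<Rightarrow> 'a) \<Rightarrow> nat \<Rightarrow> real" where
  "expected_alg1 p U v tb k =
     measure_pmf.expectation (pmf_of_set (permutations_of_set U)) (\<lambda>xs. v (alg1 p v tb k xs))"

end

theory Submission
  imports Defs "HOL-Real_Asymp.Real_Asymp"
begin

text \<open>
  Let \<open>V l c\<close> be the expected value collected from round \<open>l\<close> on when \<open>c\<close> more items may be accepted.
  Conditioned on the set of the first \<open>l\<close> items and on everything that happens later, the item arriving
  in round \<open>l\<close> is uniform among \<open>l\<close> candidates, \<open>k\<close> of which form the greedy solution \<open>S\<close>. Looking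
  backwards in time, the accepted set of the later rounds is fixed, so submodularity and monotonicity
  give \<open>l V l c \<ge> (l - k) V (l + 1) c + (k - 1) V (l + 1) (c - 1) + E (v S)\<close>.

  The prefix of length \<open>l = x n\<close> contains about \<open>x k\<close> items of the optimum only, so that \<open>k\<close> greedy steps
  yield \<open>E (v S) \<ge> x (1 - x / e - 1 / (e k)) OPT\<close>. Solving the recursion with \<open>x = exp (u - 1)\<close>
  bounds the competitive ratio from below by \<open>1 / e\<close> times the integral over \<open>u \<in> [0, 1]\<close> of
  \<open>(1 - exp (u - 2) - 1 / (e k)) P(Poisson ((k - 1) u) < k)\<close>, up to \<open>O(k / n)\<close>. Both factors decrease,
  and by Chebyshev's inequality the integral is at least the product of the two integrals. The second
  one is computed exactly and estimated with Stirling's lower bound for the factorial.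
\<close>

lemma exp1_gt_2: "exp (1::real) > 2"
  using exp_ge_one_plus_x_over_n_power_n[of 2 "1::real"] by (simp add: power2_eq_square)

subsection \<open>Stirling's lower bound\<close>

text \<open>The logarithm \<open>b n\<close> of \<open>n! * e^n / n^(n + 1/2)\<close> decreases, so
  it stays above its limit, and Wallis' product identifies that limit as
  \<open>ln (2 * pi) / 2\<close>.\<close>

lemma stirling_lower:
  assumes "m \<ge> 1"
  shows "sqrt (2 * pi * m) * (real m / exp 1) ^ m \<le> fact m"
proof -
  define b where "b n = ln (fact n :: real) + real n - (real n + 1/2) * ln (real n)" for n :: nat
  have step: "b n - b (Suc n) = (real n + 1/2) * (ln (real n + 1) - ln (real n)) - 1" if "n \<ge> 1" for n
  proof -
    have "ln (fact (Suc n) :: real) = ln (real n + 1) + ln (fact n)"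
      by (simp add: ln_mult add.commute)
    then show ?thesis unfolding b_def by (simp add: algebra_simps)
  qed
  \<comment> \<open>Convexity of 1/t: its integral over [n, n + 1] is at least the value at the
    midpoint.\<close>
  have dec1: "b (Suc n) \<le> b n" if n: "n \<ge> 1" for n
  proof -
    have "2 / (2 * real n + 1) \<le> ln (real n + 1) - ln (real n)"
      using ln_inverse_approx_ge[of "real n" "real n + 1"] n by (simp add: field_simps)
    then have "(real n + 1/2) * (2 / (2 * real n + 1)) \<le> (real n + 1/2) * (ln (real n + 1) - ln (real n))"
      by (intro mult_left_mono) auto
    then show ?thesis using step[OF n] by (simp add: field_simps)
  qed
  have dec: "b (j + n) \<le> b n" if "n \<ge> 1" for n j
    
  proof (induction j)
    case (Suc j)
    show ?case using dec1[of "j + n"] that Suc by simp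
  qed simp
  \<comment> \<open>The trapezoid rule overestimates the same integral, and the excess telescopes.
    Hence \<open>b\<close> is bounded below and converges.\<close>
  have inc: "b n - 1 / (4 * real n) \<le> b (Suc n) - 1 / (4 * real (Suc n))" if n: "n \<ge> 1" for n
  proof -
    have "ln (real n + 1) - ln (real n) \<le> (1 / real n + 1 / (real n + 1)) / 2"
      using ln_inverse_approx_le[of "real n" 1] n by (simp add: field_simps)
    then have "(real n + 1/2) * (ln (real n + 1) - ln (real n))
        \<le> (real n + 1/2) * ((1 / real n + 1 / (real n + 1)) / 2)"
      by (intro mult_left_mono) auto
    also have "\<dots> - 1 = 1 / (4 * real n) - 1 / (4 * real (Suc n))"
      using n by (simp add: divide_simps) (simp add: algebra_simps)
    finally show ?thesis using step[OF n] by simp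
  qed
  have "b 1 - 1/4 \<le> b (Suc n) - 1 / (4 * real (Suc n))" for n
  proof (induction n)
    case (Suc n)
    then show ?case using inc[of "Suc n"] by simp
  qed simp
  moreover have "1 / (4 * real (Suc n)) \<ge> 0" for n by simp
  ultimately have lb: "b (Suc n) \<ge> b 1 - 1/4" for n
    by (smt (verit))
  have decs: "decseq (\<lambda>n. b (Suc n))"
    using dec[where j = 1] by (intro decseq_SucI) simp
  obtain L where L: "(\<lambda>n. b (Suc n)) \<longlonglongrightarrow> L" and Lb: "\<And>n. L \<le> b (Suc n)"
    using decseq_convergent[OF decs, of "b 1 - 1/4"] lb by blast
  \<comment> \<open>Wallis' partial products tend to pi / 2. In factorial form their logarithm
    involves \<open>b\<close> only through \<open>2 * b n - b (2 * n)\<close>, so the limit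
    \<open>L\<close> can be solved for.\<close>
  define w where "w n = (\<Prod>k=1..n. (4*real k^2) / (4*real k^2 - 1))" for n
  have w_eq: "w n = (4 ^ n * fact n ^ 2 / fact (2 * n)) ^ 2 / (2 * real n + 1)" for n
  proof (induction n)
    case (Suc n)
    define c d e where "c = real n + 1" and "d = 2 * real n + 1" and "e = 2 * real n + 3"
    have nz: "c \<noteq> 0" "d \<noteq> 0" "e \<noteq> 0" by (auto simp: c_def d_def e_def)
    have "w (Suc n) = w n * ((4*real (Suc n)^2) / (4*real (Suc n)^2 - 1))"
      by (simp add: w_def)
    also have "4*real (Suc n)^2 - 1 = d * e"
      by (simp add: algebra_simps power2_eq_square d_def e_def)
    also have "real (Suc n) = c" by (simp add: c_def)
    also have "w n = (4 ^ n * fact n ^ 2 / fact (2 * n)) ^ 2 / d"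
      unfolding Suc d_def ..
    also have "\<dots> * (4 * c\<^sup>2 / (d * e)) = (4 ^ Suc n * (c * fact n)\<^sup>2 / (2 * c * d * fact (2 * n)))\<^sup>2 / e"
      using nz by (simp add: field_simps power2_eq_square)
    also have "2 * c * d * fact (2 * n) = fact (2 * Suc n)"
      by (simp add: algebra_simps c_def d_def)
    also have "c * fact n = fact (Suc n)" by (simp add: c_def algebra_simps)
    also have "e = 2 * real (Suc n) + 1" by (simp add: e_def)
    finally show ?case .
  qed (simp add: w_def)
  have w_ln: "ln (w n) = 2 * (2 * b n - b (2 * n)) + ln (real n) - ln 2 - ln (2 * real n + 1)"
    if n: "n \<ge> 1" for n
  proof -
    have "ln (w n) = 2 * (n * ln 4 + 2 * ln (fact n) - ln (fact (2 * n))) - ln (2 * real n + 1)"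
      using n unfolding w_eq
      by (simp add: ln_div ln_mult ln_realpow)
    moreover have "ln (4::real) = 2 * ln 2" using ln_realpow[of 2 2] by simp
    ultimately show ?thesis using n unfolding b_def
      by (simp add: ln_mult algebra_simps)
  qed
  have "(\<lambda>n. ln (w n)) \<longlonglongrightarrow> ln (pi / 2)"
    using wallis unfolding w_def[symmetric, abs_def] by (intro tendsto_ln) auto
  moreover have "(\<lambda>n. ln (real n) - ln 2 - ln (2 * real n + 1)) \<longlonglongrightarrow> - 2 * ln 2"
    by real_asymp
  moreover have bL: "b \<longlonglongrightarrow> L" using L by (rule LIMSEQ_imp_Suc)
  moreover have "(\<lambda>n. b (2 * n)) \<longlonglongrightarrow> L"
    using LIMSEQ_subseq_LIMSEQ[OF bL, of "\<lambda>n. 2 * n"]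
    by (simp add: strict_mono_def o_def)
  ultimately have "(\<lambda>n. 2 * (2 * b n - b (2 * n)) + (ln (real n) - ln 2 - ln (2 * real n + 1)))
      \<longlonglongrightarrow> 2 * (2 * L - L) + (- 2 * ln 2)"
    by (intro tendsto_intros)
  moreover have "\<forall>\<^sub>F n in sequentially. ln (w n) =
      2 * (2 * b n - b (2 * n)) + (ln (real n) - ln 2 - ln (2 * real n + 1))"
    using eventually_ge_at_top[of 1] by eventually_elim (simp add: w_ln)
  ultimately have "(\<lambda>n. ln (w n)) \<longlonglongrightarrow> 2 * L - 2 * ln 2"
    by (simp add: tendsto_cong)
  with \<open>(\<lambda>n. ln (w n)) \<longlonglongrightarrow> ln (pi / 2)\<close> have "2 * L - 2 * ln 2 = ln (pi / 2)"
    using LIMSEQ_unique by blast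
  then have "L = ln (2 * pi) / 2" by (simp add: ln_mult ln_div)
  moreover have "L \<le> b m" using Lb[of "m - 1"] assms by simp
  ultimately have "ln (2 * pi) / 2 + (real m + 1/2) * ln (real m) - real m \<le> ln (fact m)"
    unfolding b_def by simp
  moreover have "ln (sqrt (2 * pi * m) * (real m / exp 1) ^ m)
      = ln (2 * pi) / 2 + (real m + 1/2) * ln (real m) - real m"
    using assms by (simp add: ln_mult ln_sqrt ln_realpow ln_div algebra_simps)
  ultimately show ?thesis
    using assms by (subst ln_le_cancel_iff[symmetric]) auto
qed

subsection \<open>Poisson tails\<close>

definition pois :: "nat \<Rightarrow> real \<Rightarrow> real" where
  "pois j x = exp (- x) * x ^ j / fact j"

text \<open>The probability of strictly fewer than \<open>c\<close> events at mean \<open>x\<close>: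
  a capacity of \<open>c\<close> is not yet used up.\<close>

definition pois_cdf :: "nat \<Rightarrow> real \<Rightarrow> real" where
  "pois_cdf c x = (\<Sum>j<c. pois j x)"

lemma pois_cdf_0 [simp]: "pois_cdf 0 x = 0"
  by (simp add: pois_cdf_def)

lemma pois_cdf_Suc: "pois_cdf (Suc c) x = pois_cdf c x + pois c x"
  by (simp add: pois_cdf_def)

lemma pois_nonneg: "x \<ge> 0 \<Longrightarrow> pois j x \<ge> 0"
  by (simp add: pois_def)

lemma pois_cdf_nonneg: "x \<ge> 0 \<Longrightarrow> pois_cdf c x \<ge> 0"
  by (simp add: pois_cdf_def pois_nonneg sum_nonneg)

lemma pois_cdf_Suc_at_0 [simp]: "pois_cdf (Suc c) 0 = 1"
  by (induction c) (simp_all add: pois_cdf_def pois_def)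

lemma pois_Suc_mult: "(real j + 1) * pois (Suc j) x = x * pois j x"
  by (simp add: pois_def divide_simps)

lemma pois_has_derivative:
  "(pois j has_real_derivative ((if j = 0 then 0 else pois (j - 1) x) - pois j x)) (at x)"
proof (cases j)
  case 0
  then show ?thesis unfolding pois_def by (auto intro!: derivative_eq_intros)
next
  case (Suc i)
  have "((\<lambda>x. exp (- x) * x ^ Suc i / fact (Suc i)) has_real_derivative
      ((- exp (- x)) * x ^ Suc i + exp (- x) * (real (Suc i) * x ^ i)) / fact (Suc i)) (at x)"
    by (rule derivative_eq_intros refl | simp)+
  also have "((- exp (- x)) * x ^ Suc i + exp (- x) * (real (Suc i) * x ^ i)) / fact (Suc i)
      = pois i x - pois (Suc i) x"
    by (simp add: pois_def divide_simps)
  finally show ?thesis unfolding pois_def[abs_def] Suc by simp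
qed

text \<open>The derivatives of the weights telescope, and only the top index survives.\<close>

lemma pois_cdf_has_derivative: "(pois_cdf (Suc c) has_real_derivative - pois c x) (at x)"
proof (induction c)
  case 0
  show ?case using pois_has_derivative[of 0 x]
    by (simp add: pois_cdf_def[abs_def])
next
  case (Suc c)
  have "((\<lambda>x. pois_cdf (Suc c) x + pois (Suc c) x) has_real_derivative
      - pois c x + (pois c x - pois (Suc c) x)) (at x)"
    using pois_has_derivative[of "Suc c" x] by (intro DERIV_add Suc) simp
  then show ?case by (simp add: pois_cdf_Suc[of "Suc c", abs_def])
qed

lemma continuous_on_pois_cdf: "continuous_on A (pois_cdf c)"
  unfolding pois_cdf_def[abs_def] pois_def by (intro continuous_intros) auto

lemma pois_cdf_antimono:
  assumes "0 \<le> x" "x \<le> y"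
  shows "pois_cdf c y \<le> pois_cdf c x"
proof (cases c)
  case (Suc c')
  show ?thesis unfolding Suc
  proof (rule DERIV_nonpos_imp_nonincreasing[OF assms(2)])
    fix t assume "x \<le> t" "t \<le> y"
    then show "\<exists>y. (pois_cdf (Suc c') has_real_derivative y) (at t) \<and> y \<le> 0"
      using pois_cdf_has_derivative[of c' t] pois_nonneg[of t c'] assms(1)
      by (intro exI[of _ "- pois c' t"]) auto
  qed
qed simp

lemma pois_cdf_le_1:
  assumes "x \<ge> 0"
  shows "pois_cdf c x \<le> 1"
proof -
  have "pois_cdf c x \<le> pois_cdf c 0" using assms by (rule pois_cdf_antimono[OF order_refl])
  also have "\<dots> \<le> 1"
    by (cases c) simp_all
  finally show ?thesis .
qed

text \<open>A Bernoulli variable of parameter \<open>1 - exp (-\<mu>)\<close> is stochastically dominated by a Poisson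
  variable of mean \<open>\<mu>\<close>; adding an independent Poisson variable of mean \<open>x\<close> gives the claim.\<close>

lemma pois_cdf_add_le:
  assumes "x \<ge> 0" "\<mu> \<ge> 0"
  shows "pois_cdf (Suc c) (x + \<mu>) \<le> exp (-\<mu>) * pois_cdf (Suc c) x + (1 - exp (-\<mu>)) * pois_cdf c x"
proof -
  \<comment> \<open>The domination is checked by calculus: \<open>f\<close> vanishes at 0 and its
    derivative is a positive multiple of \<open>(x + t) ^ c - x ^ c\<close>.\<close>
  define f where "f t = exp (-t) * pois_cdf (Suc c) x + (1 - exp (-t)) * pois_cdf c x
    - pois_cdf (Suc c) (x + t)" for t
  have "f 0 \<le> f \<mu>"
  proof (rule DERIV_nonneg_imp_nondecreasing[OF assms(2)])
    fix t assume t: "0 \<le> t" "t \<le> \<mu>"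
    have "((\<lambda>t. pois_cdf (Suc c) (x + t)) has_real_derivative - pois c (x + t)) (at t)"
      using DERIV_shift[of "pois_cdf (Suc c)" "- pois c (x + t)" t x] pois_cdf_has_derivative[of c "x + t"]
      by (simp add: add.commute)
    then have "(f has_real_derivative (- exp (-t)) * pois_cdf (Suc c) x + exp (-t) * pois_cdf c x
        + pois c (x + t)) (at t)"
      unfolding f_def by (auto intro!: derivative_eq_intros)
    moreover have "(- exp (-t)) * pois_cdf (Suc c) x + exp (-t) * pois_cdf c x + pois c (x + t)
        = exp (- x - t) * ((x + t) ^ c - x ^ c) / fact c"
      by (simp add: pois_cdf_Suc pois_def exp_diff exp_minus divide_simps exp_add)
    moreover have "\<dots> \<ge> 0"
      using assms t by (intro divide_nonneg_nonneg mult_nonneg_nonneg) (auto intro: power_mono)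
    ultimately show "\<exists>y. (f has_real_derivative y) (at t) \<and> 0 \<le> y" by auto
  qed
  then show ?thesis by (simp add: f_def)
qed

text \<open>To be used with m = k - 1. An exact antiderivative leaves a loss governed by
  \<open>pois m m\<close>, which Stirling's bound controls.\<close>

lemma pois_cdf_integral:
  assumes m: "m \<ge> 1"
  shows "1 - sqrt (real m) / ((real m + 2) * sqrt (2 * pi)) \<le> integral {0..1} (\<lambda>u. pois_cdf (Suc m) (real m * u))"
proof -
  \<comment> \<open>Integration by parts: \<open>m * u * pois m (m * u)\<close> equals
    \<open>(m + 1) * pois (m + 1) (m * u)\<close>, whose integral is again expressed by
    \<open>pois_cdf\<close>.\<close>
  define A :: "real \<Rightarrow> real" where "A = (\<lambda>u :: real. u * pois_cdf (Suc m) (m * u)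
    + (real m + 1) / m * (1 - pois_cdf (Suc (Suc m)) (m * u)))"
  have chain: "((\<lambda>u. pois_cdf (Suc c) (m * u)) has_real_derivative - pois c (m * u) * m) (at u)" for c and u :: real
    by (rule DERIV_chain'[where f = "\<lambda>u. m * u", OF _ pois_cdf_has_derivative])
      (auto intro!: derivative_eq_intros)
  have "(A has_real_derivative pois_cdf (Suc m) (m * u)) (at u)" for u :: real
  proof -
    have "(A has_real_derivative (pois_cdf (Suc m) (m * u) - u * (pois m (m * u) * m)
        + (real m + 1) / m * (pois (Suc m) (m * u) * m))) (at u)"
      unfolding A_def by (rule derivative_eq_intros chain refl | simp)+
    also have "(real m + 1) / m * (pois (Suc m) (m * u) * m) = (real m + 1) * pois (Suc m) (m * u)"
      using m by simp
    finally show ?thesis by (simp add: pois_Suc_mult mult_ac)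
  qed
  then have "((\<lambda>u. pois_cdf (Suc m) (m * u)) has_integral (A 1 - A 0)) {0..1}"
    by (intro fundamental_theorem_of_calculus)
      (auto simp: has_real_derivative_iff_has_vector_derivative[symmetric] intro: has_field_derivative_at_within)
  then have "integral {0..1} (\<lambda>u. pois_cdf (Suc m) (m * u)) = A 1 - A 0"
    by (rule integral_unique)
  moreover have "A 0 = 0"
    by (simp add: A_def)
  moreover have "A 1 \<ge> 1 - pois m m * (m / (real m + 2))"
  proof -
    \<comment> \<open>Both distribution functions in \<open>A 1\<close> are rewritten through
      \<open>Q\<close>. The two extra weights combine into the denominator m + 2, which becomes k +
      1, and only the nonnegative term \<open>(1 - Q) / m\<close> is dropped.\<close>
    define Q where "Q = pois_cdf (Suc (Suc (Suc m))) m"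
    have p1: "pois (Suc m) m = pois m m * (m / (real m + 1))"
      using pois_Suc_mult[of m m] by (simp add: field_simps)
    have p2: "pois (Suc (Suc m)) m = pois m m * (m / (real m + 1)) * (m / (real m + 2))"
      using pois_Suc_mult[of "Suc m" m] unfolding p1 by (simp add: divide_simps) (simp add: algebra_simps)
    have "A 1 = 1 + (1 - Q) / m - pois (Suc m) m + pois (Suc (Suc m)) m / m"
      using m unfolding A_def Q_def pois_cdf_Suc[of "Suc m"] pois_cdf_Suc[of "Suc (Suc m)"]
      by (simp add: divide_simps) (simp add: algebra_simps)
    also have "pois (Suc (Suc m)) m / m = pois m m * (m / ((real m + 1) * (real m + 2)))"
      using m unfolding p2 by (simp add: divide_simps)
    also have "1 + (1 - Q) / m - pois (Suc m) m + \<dots>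
      = 1 - pois m m * (m / (real m + 2)) + (1 - Q) / m"
      using m unfolding p1 by (simp add: divide_simps) (simp add: algebra_simps)
    also have "\<dots> \<ge> 1 - pois m m * (m / (real m + 2))"
      using pois_cdf_le_1[of m] unfolding Q_def by simp
    finally show ?thesis .
  qed
  moreover have "pois m m \<le> 1 / sqrt (2 * pi * m)"
    using stirling_lower[OF m] m
    by (simp add: pois_def exp_minus power_divide exp_of_nat_mult[symmetric] divide_simps mult.commute)
  then have p3: "pois m m * (m / (real m + 2)) \<le> 1 / sqrt (2 * pi * m) * (m / (real m + 2))"
    by (rule mult_right_mono) simp
  moreover have "1 / sqrt (2 * pi * m) * (m / (real m + 2)) = sqrt m / ((real m + 2) * sqrt (2 * pi))"
    using m by (simp add: real_sqrt_mult divide_simps)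
  ultimately show ?thesis using p3 by linarith
qed

subsection \<open>Integrals of decreasing functions\<close>

text \<open>Let t be a point where \<open>g\<close> attains its mean \<open>G\<close>. As both
  functions decrease, \<open>(f x - f t) * (g x - G)\<close> is nonnegative; after integration the
  terms with \<open>f t\<close> cancel.\<close>

lemma integral_Chebyshev:
  fixes f g :: "real \<Rightarrow> real"
  assumes f: "continuous_on {0..1} f" "antimono_on {0..1} f"
    and g: "continuous_on {0..1} g" "antimono_on {0..1} g"
  shows "integral {0..1} f * integral {0..1} g \<le> integral {0..1} (\<lambda>x. f x * g x)"
proof -
  define G where "G = integral {0..1} g"
  have int: "f integrable_on {0..1}" "g integrable_on {0..1}" "(\<lambda>x. f x * g x) integrable_on {0..1}"
    using f g by (auto intro!: integrable_continuous_real continuous_intros)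
  have "g 1 \<le> g x" "g x \<le> g 0" if "x \<in> {0..1}" for x
    using that g(2) by (auto simp: monotone_on_def)
  then have "g 1 \<le> G" "G \<le> g 0"
    using integral_le[OF integrable_const_ivl int(2), of "g 1"] integral_le[OF int(2) integrable_const_ivl, of "g 0"]
    by (auto simp: G_def)
  then obtain t where t: "t \<in> {0..1}" "g t = G"
    using IVT2'[of g 1 G 0] g(1) by auto
  have "0 \<le> (f x - f t) * (g x - G)" if "x \<in> {0..1}" for x
    using f(2) g(2) t that
    by (cases "x \<le> t") (auto simp: monotone_on_def mult_nonneg_nonneg mult_nonpos_nonpos)
  then have "0 \<le> integral {0..1} (\<lambda>x. (f x - f t) * (g x - G))"
    by (intro integral_nonneg integrable_continuous_real continuous_intros f g) auto
  also have "((\<lambda>x. f x * g x - G * f x - (f t * g x - f t * G)) has_integral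
      (integral {0..1} (\<lambda>x. f x * g x) - G * integral {0..1} f - (f t * G - f t * G))) {0..1}"
    using has_integral_const_real[of "f t * G" 0 1] int has_integral_mult_right[OF integrable_integral[OF int(2)], of "f t"]
    by (intro has_integral_diff has_integral_mult_right[OF integrable_integral]) (auto simp: G_def)
  then have "integral {0..1} (\<lambda>x. (f x - f t) * (g x - G)) = integral {0..1} (\<lambda>x. f x * g x) - G * integral {0..1} f"
    by (simp add: integral_unique algebra_simps)
  finally show ?thesis by (simp add: G_def mult.commute)
qed

text \<open>On each cell a decreasing function is at most its value at the left end. The nodes may
  be unevenly spaced, as the logarithmic grid used later requires.\<close>

lemma integral_le_left_sum:
  fixes h :: "real \<Rightarrow> real" and u :: "nat \<Rightarrow> real"
  assumes ab: "a \<le> b" and u: "\<And>i. a \<le> i \<Longrightarrow> i < b \<Longrightarrow> u i \<le> u (Suc i)"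
    and h: "continuous_on {u a..u b} h" "antimono_on {u a..u b} h"
  shows "integral {u a..u b} h \<le> (\<Sum>i=a..<b. h (u i) * (u (Suc i) - u i))"
  using ab u h
proof (induction b rule: dec_induct)
  case (step b)
  have mono: "u a \<le> u b"
    using step(1,2) step.prems(1) by (induction b rule: dec_induct) (auto intro: order_trans less_imp_le)
  have ub: "u b \<le> u (Suc b)" using step by auto
  have sub: "{u a..u b} \<subseteq> {u a..u (Suc b)}" "{u b..u (Suc b)} \<subseteq> {u a..u (Suc b)}"
    using mono ub by auto
  have "integral {u b..u (Suc b)} h \<le> integral {u b..u (Suc b)} (\<lambda>_. h (u b))"
    using step.prems(3) mono ub
    by (intro integral_le integrable_continuous_real continuous_on_subset[OF step.prems(2) sub(2)])
      (auto simp: monotone_on_def)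
  also have "\<dots> = h (u b) * (u (Suc b) - u b)" using ub by simp
  finally have "integral {u b..u (Suc b)} h \<le> h (u b) * (u (Suc b) - u b)" .
  moreover have "integral {u a..u b} h \<le> (\<Sum>i=a..<b. h (u i) * (u (Suc i) - u i))"
    using step.prems sub(1)
    by (intro step.IH) (auto intro: continuous_on_subset monotone_on_subset)
  moreover have "integral {u a..u (Suc b)} h = integral {u a..u b} h + integral {u b..u (Suc b)} h"
    using mono ub step.prems(2)
    by (intro Henstock_Kurzweil_Integration.integral_combine[symmetric] integrable_continuous_real) auto
  ultimately show ?case using step(1) by simp
qed simp

subsection \<open>Submodular functions and the greedy algorithm\<close>

locale submodular_secretary =
  fixes U :: "'a set" and v :: "'a set \<Rightarrow> real" and tb :: "'a set \<Rightarrow> 'a" and k :: nat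
  assumes finU: "finite U"
    and nonneg: "nonneg_setfun U v"
    and mono: "monotone_setfun U v"
    and submod: "submodular_setfun U v"
    and tie: "tie_rule tb"
    and k_pos: "k \<ge> 1"
begin

lemma v_nonneg: "S \<subseteq> U \<Longrightarrow> 0 \<le> v S"
  using nonneg by (simp add: nonneg_setfun_def)

lemma v_mono: "S \<subseteq> T \<Longrightarrow> T \<subseteq> U \<Longrightarrow> v S \<le> v T"
  using mono by (simp add: monotone_setfun_def)

text \<open>For x outside \<open>B\<close>, submodularity is applied to \<open>insert x A\<close>
  and \<open>B\<close>, which meet in \<open>A\<close>. For x in \<open>B\<close> the left side is
  zero and monotonicity suffices.\<close>

lemma marginal_antimono:
  assumes "A \<subseteq> B" "B \<subseteq> U" "x \<in> U"
  shows "v (insert x B) - v B \<le> v (insert x A) - v A"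
proof (cases "x \<in> B")
  case True
  then show ?thesis using v_mono[of A "insert x A"] assms by (auto simp: insert_absorb)
next
  case False
  have "insert x A \<subseteq> U" using assms by auto
  from submod[unfolded submodular_setfun_def, rule_format, OF conjI[OF this assms(2)]]
  have "v (insert x A \<union> B) + v (insert x A \<inter> B) \<le> v (insert x A) + v B" .
  moreover have "insert x A \<union> B = insert x B" "insert x A \<inter> B = A"
    using assms False by auto
  ultimately show ?thesis by simp
qed

lemma sum_marginals_ge:
  assumes "S \<subseteq> U" "B \<subseteq> U"
  shows "v (S \<union> B) - v B \<le> (\<Sum>x\<in>S. v (insert x B) - v B)"
proof -
  have "finite S" using assms finU finite_subset by blast
  then show ?thesis using assms(1)
  proof (induction S rule: finite_induct)
    case (insert x S)
    then show ?case
      using marginal_antimono[of B "S \<union> B" x] assms(2) by simp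
  qed simp
qed

abbreviation greedy_iter :: "'a set \<Rightarrow> nat \<Rightarrow> 'a set" where
  "greedy_iter L i \<equiv> (greedy_step v tb L ^^ i) {}"

lemma greedy_step_insert:
  assumes "finite L" "\<not> L \<subseteq> S"
  obtains x where "greedy_step v tb L S = insert x S" "x \<in> L" "x \<notin> S"
    "\<And>y. y \<in> L - S \<Longrightarrow> v (insert y S) - v S \<le> v (insert x S) - v S"
proof -
  define T where "T = {x \<in> L - S. \<forall>y \<in> L - S. v (insert y S) - v S \<le> v (insert x S) - v S}"
  define F where "F x = v (insert x S) - v S" for x
  have "finite (L - S)" "L - S \<noteq> {}" using assms by auto
  then obtain x where "x \<in> L - S" "F x = Max (F ` (L - S))"
    using Max_in[of "F ` (L - S)"] by fastforce
  then have "x \<in> T" using \<open>finite (L - S)\<close> by (auto simp: T_def F_def[symmetric])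
  then have "tb T \<in> T" using tie unfolding tie_rule_def by blast
  then show ?thesis
    using that[of "tb T"] by (auto simp: T_def greedy_step_def)
qed

lemma greedy_iter_subset_card:
  assumes "finite L" "i \<le> card L"
  shows "greedy_iter L i \<subseteq> L \<and> card (greedy_iter L i) = i"
  using assms(2)
proof (induction i)
  case (Suc i)
  define S where "S = greedy_iter L i"
  have S: "S \<subseteq> L" "card S = i" using Suc by (auto simp: S_def)
  have "finite S" using S(1) assms(1) by (rule finite_subset)
  have "\<not> L \<subseteq> S" using card_mono[OF \<open>finite S\<close>, of L] S(2) Suc.prems by linarith
  with assms(1) obtain x where "greedy_step v tb L S = insert x S" "x \<in> L" "x \<notin> S"
    by (rule greedy_step_insert)
  then show ?case using S \<open>finite S\<close> by (simp add: S_def)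
qed simp

text \<open>The best available item gains at least the average gain over \<open>Q\<close>, so each
  step closes a fraction 1/|Q| of the gap. The number of steps is independent of |Q|, since a prefix
  may contain only few optimal items.\<close>

lemma greedy_iter_gap:
  assumes "L \<subseteq> U" "Q \<subseteq> L" "Q \<noteq> {}" "i \<le> card L"
  shows "v Q - v (greedy_iter L i) \<le> (1 - 1 / real (card Q)) ^ i * v Q"
  using assms(4)
proof (induction i)
  case 0
  then show ?case using v_nonneg[of "{}"] by simp
next
  case (Suc i)
  define S where "S = greedy_iter L i"
  have finL: "finite L" using assms finU finite_subset by blast
  have S: "S \<subseteq> L" "card S = i"
    using greedy_iter_subset_card[OF finL, of i] Suc.prems by (auto simp: S_def)
  then have "\<not> L \<subseteq> S" using Suc.prems finL card_mono[of S L] finite_subset by fastforce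
  then obtain x where x: "greedy_step v tb L S = insert x S" "x \<in> L" "x \<notin> S"
    and best: "\<And>y. y \<in> L - S \<Longrightarrow> v (insert y S) - v S \<le> v (insert x S) - v S"
    using greedy_step_insert[OF finL] by blast
  define h where "h = real (card Q)"
  have h: "h \<ge> 1" using assms finL finite_subset[of Q L] by (auto simp: h_def Suc_le_eq card_gt_0_iff)
  have sub: "S \<subseteq> U" "Q \<subseteq> U" "insert x S \<subseteq> U" using S assms x by auto
  have gain: "0 \<le> v (insert x S) - v S" using v_mono[of S "insert x S"] sub by auto
  have "v Q \<le> v (Q \<union> S)" using sub by (intro v_mono) auto
  also have "v (Q \<union> S) - v S \<le> (\<Sum>y\<in>Q. v (insert y S) - v S)"
    using sub by (intro sum_marginals_ge) auto
  also have "\<dots> \<le> (\<Sum>y\<in>Q. v (insert x S) - v S)"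
  proof (rule sum_mono)
    fix y assume "y \<in> Q"
    then show "v (insert y S) - v S \<le> v (insert x S) - v S"
      using best[of y] gain assms by (cases "y \<in> S") (auto simp: insert_absorb)
  qed
  also have "\<dots> = h * (v (insert x S) - v S)" by (simp add: h_def)
  finally have "(v Q - v S) / h \<le> v (insert x S) - v S"
    using h by (simp add: field_simps)
  then have "v Q - v (insert x S) \<le> (1 - 1 / h) * (v Q - v S)"
    by (simp add: algebra_simps diff_divide_distrib)
  also have "\<dots> \<le> (1 - 1 / h) * ((1 - 1 / h) ^ i * v Q)"
    using Suc.IH Suc.prems h by (intro mult_left_mono) (auto simp: S_def h_def)
  also have "insert x S = greedy_iter L (Suc i)" using x(1) by (simp add: S_def)
  finally show ?case by (simp add: h_def mult_ac)
qed

definition greedy_k :: "'a set \<Rightarrow> 'a set" where "greedy_k = greedy v tb k"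

lemma greedy_k_eq_iter: "k \<le> card L \<Longrightarrow> greedy_k L = greedy_iter L k"
  by (simp add: greedy_k_def greedy_def)

lemma greedy_k_subset_card:
  assumes "finite L" "k \<le> card L"
  shows "greedy_k L \<subseteq> L" "card (greedy_k L) = k"
  using greedy_iter_subset_card[OF assms] unfolding greedy_k_eq_iter[OF assms(2)] by auto

text \<open>The bounds 1 - y <= exp (-y) and exp y >= e y reduce the geometric factor to |Q| / (e
  k). Being linear in |Q|, it can be averaged over random prefixes using only probabilities for
  single items and pairs.\<close>

lemma greedy_k_ge:
  assumes "L \<subseteq> U" "Q \<subseteq> L" "k \<le> card L"
  shows "(1 - real (card Q) / (exp 1 * k)) * v Q \<le> v (greedy_k L)"
proof (cases "Q = {}")
  case True
  have "finite L" using assms finU finite_subset by blast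
  then show ?thesis using True v_mono[of "{}" "greedy_k L"] greedy_k_subset_card[of L] assms by auto
next
  case False
  define h where "h = real (card Q)"
  have "finite Q" using assms finU finite_subset by metis
  then have h: "h \<ge> 1" using False by (auto simp: h_def Suc_le_eq card_gt_0_iff)
  have "(1 - 1 / h) ^ k \<le> exp (- (1 / h)) ^ k"
    using exp_ge_add_one_self[of "- (1 / h)"] h by (intro power_mono) auto
  also have "\<dots> = exp (- (k / h))" by (simp add: exp_of_nat_mult[symmetric])
  also have "\<dots> \<le> 1 / (exp 1 * (k / h))"
  proof -
    have "exp 1 * (k / h) \<le> exp 1 * exp (k / h - 1)"
      using exp_ge_add_one_self[of "k / h - 1"] by (intro mult_left_mono) auto
    also have "\<dots> = exp (k / h)" by (simp add: exp_add[symmetric])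
    finally show ?thesis using h k_pos unfolding exp_minus inverse_eq_divide
      by (intro divide_left_mono mult_pos_pos divide_pos_pos) auto
  qed
  also have "\<dots> = h / (exp 1 * k)" by simp
  finally have "(1 - 1 / h) ^ k * v Q \<le> h / (exp 1 * k) * v Q"
    using v_nonneg[of Q] assms by (intro mult_right_mono) auto
  moreover have "v Q - v (greedy_k L) \<le> (1 - 1 / h) ^ k * v Q"
    using greedy_iter_gap[of L Q k] assms False by (simp add: greedy_k_eq_iter h_def)
  ultimately show ?thesis by (simp add: h_def algebra_simps)
qed

end

subsection \<open>Averages over uniformly random orders\<close>

definition perm_avg :: "'a set \<Rightarrow> ('a list \<Rightarrow> real) \<Rightarrow> real" where
  "perm_avg U f = (\<Sum>xs\<in>permutations_of_set U. f xs) / fact (card U)"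

lemma expectation_perm_eq_avg:
  "finite U \<Longrightarrow> measure_pmf.expectation (pmf_of_set (permutations_of_set U)) f = perm_avg U f"
  by (subst integral_pmf_of_set) (auto simp: perm_avg_def)

lemma perm_avg_const: "finite U \<Longrightarrow> perm_avg U (\<lambda>_. c) = c"
  by (simp add: perm_avg_def)

lemma perm_avg_add: "perm_avg U (\<lambda>xs. f xs + g xs) = perm_avg U f + perm_avg U g"
  by (simp add: perm_avg_def sum.distrib add_divide_distrib)

lemma perm_avg_diff: "perm_avg U (\<lambda>xs. f xs - g xs) = perm_avg U f - perm_avg U g"
  by (simp add: perm_avg_def sum_subtractf diff_divide_distrib)

lemma perm_avg_cmult: "perm_avg U (\<lambda>xs. c * f xs) = c * perm_avg U f"
  by (simp add: perm_avg_def sum_distrib_left)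

lemma perm_avg_sum: "perm_avg U (\<lambda>xs. \<Sum>i\<in>A. f i xs) = (\<Sum>i\<in>A. perm_avg U (f i))"
  unfolding perm_avg_def by (subst sum.swap) (simp add: sum_divide_distrib)

lemma perm_avg_mono:
  "(\<And>xs. xs \<in> permutations_of_set U \<Longrightarrow> f xs \<le> g xs) \<Longrightarrow> perm_avg U f \<le> perm_avg U g"
  unfolding perm_avg_def by (intro divide_right_mono sum_mono) auto

lemma perm_avg_cong:
  "(\<And>xs. xs \<in> permutations_of_set U \<Longrightarrow> f xs = g xs) \<Longrightarrow> perm_avg U f = perm_avg U g"
  unfolding perm_avg_def by (intro arg_cong2[where f = "(/)"] sum.cong refl) auto

text \<open>Symmetry between items: relabelling is a bijection of the arrival orders.\<close>

lemma perm_avg_relabel: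
  assumes "\<pi> permutes U"
  shows "perm_avg U (\<lambda>xs. f (map \<pi> xs)) = perm_avg U f"
proof -
  have "inj_on (map \<pi>) (permutations_of_set U)"
    using inj_mapI[OF permutes_inj[OF assms]] by (rule inj_on_subset) simp
  then have "(\<Sum>xs\<in>map \<pi> ` permutations_of_set U. f xs) = (\<Sum>xs\<in>permutations_of_set U. f (map \<pi> xs))"
    by (rule sum.reindex_cong) auto
  then show ?thesis by (simp add: perm_avg_def permutations_of_set_image_permutes[OF assms])
qed

text \<open>Symmetry between rounds: rearranging positions is a bijection of the arrival orders,
  undone by the inverse permutation.\<close>

lemma perm_avg_permute_positions:
  assumes "\<pi> permutes {..<card U}"
  shows "perm_avg U (\<lambda>xs. f (permute_list \<pi> xs)) = perm_avg U f"
proof -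
  have closed: "permute_list \<sigma> xs \<in> permutations_of_set U"
    if "xs \<in> permutations_of_set U" "\<sigma> permutes {..<card U}" for xs \<sigma>
  proof -
    have "mset (permute_list \<sigma> xs) = mset xs"
      using that length_finite_permutations_of_set[OF that(1)] by simp
    then show ?thesis
      using that(1) mset_eq_setD mset_eq_imp_distinct_iff unfolding permutations_of_set_def by blast
  qed
  have inv: "inv \<pi> permutes {..<card U}" using assms by (rule permutes_inv)
  have cancel: "permute_list \<sigma> (permute_list \<tau> xs) = xs"
    if "xs \<in> permutations_of_set U" "\<sigma> permutes {..<card U}" "\<tau> \<circ> \<sigma> = id" for xs \<sigma> \<tau>
    using permute_list_compose[of \<sigma> xs \<tau>] length_finite_permutations_of_set[OF that(1)] that
    by simp
  have "bij_betw (permute_list \<pi>) (permutations_of_set U) (permutations_of_set U)"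
  proof (rule bij_betwI[where g = "permute_list (inv \<pi>)"])
    show "permute_list (inv \<pi>) (permute_list \<pi> xs) = xs" if "xs \<in> permutations_of_set U" for xs
      using that inv permutes_inv_o(1)[OF assms] by (rule cancel)
    show "permute_list \<pi> (permute_list (inv \<pi>) xs) = xs" if "xs \<in> permutations_of_set U" for xs
      using that assms permutes_inv_o(2)[OF assms] by (rule cancel)
  qed (use closed assms inv in \<open>auto intro!: funcsetI\<close>)
  then show ?thesis
    unfolding perm_avg_def using sum.reindex_bij_betw[of _ _ _ f] by auto
qed

lemma mem_transpose_image: "a \<in> Transposition.transpose x y ` A \<longleftrightarrow> Transposition.transpose x y a \<in> A"
  using inj_image_mem_iff[of "Transposition.transpose x y" "Transposition.transpose x y a" A]
  by simp

text \<open>By symmetry all items are equally likely to be in the prefix, and these probabilities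
  add up to its length.\<close>

lemma perm_avg_prefix_mem:
  assumes "finite U" "l \<le> card U" "x \<in> U"
  shows "perm_avg U (\<lambda>xs. of_bool (x \<in> set (take l xs))) = real l / card U"
proof -
  define p where "p y = perm_avg U (\<lambda>xs. of_bool (y \<in> set (take l xs)))" for y
  have "p y = p x" if "y \<in> U" for y
  proof -
    have "Transposition.transpose x y permutes U" using that assms by (intro permutes_swap_id) auto
    then have "p y = perm_avg U (\<lambda>xs. of_bool (y \<in> set (take l (map (Transposition.transpose x y) xs))))"
      unfolding p_def by (rule perm_avg_relabel[symmetric])
    also have "\<dots> = p x"
      unfolding p_def by (rule perm_avg_cong) (simp add: take_map mem_transpose_image)
    finally show ?thesis .
  qed
  then have "(\<Sum>y\<in>U. p y) = (\<Sum>y\<in>U. p x)" by (rule sum.cong[OF refl])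
  then have "card U * p x = (\<Sum>y\<in>U. p y)" by simp
  also have "\<dots> = perm_avg U (\<lambda>xs. \<Sum>y\<in>U. of_bool (y \<in> set (take l xs)))"
    by (simp add: p_def perm_avg_sum)
  also have "\<dots> = perm_avg U (\<lambda>xs. real l)"
  proof (rule perm_avg_cong)
    fix xs assume xs: "xs \<in> permutations_of_set U"
    have "(\<Sum>y\<in>U. of_bool (y \<in> set (take l xs))) = real (card (U \<inter> set (take l xs)))"
      using assms by (simp add: sum.If_cases of_bool_def Int_def)
    also have "U \<inter> set (take l xs) = set (take l xs)"
      using xs by (auto simp: permutations_of_set_def dest: in_set_takeD)
    also have "card (set (take l xs)) = l"
      using xs assms length_finite_permutations_of_set[OF xs]
      by (simp add: permutations_of_set_def distinct_card)
    finally show "(\<Sum>y\<in>U. of_bool (y \<in> set (take l xs))) = real l" .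
  qed
  finally have "card U * p x = real l" using assms by (simp add: perm_avg_const)
  moreover have "card U > 0" using assms by (auto simp: card_gt_0_iff)
  ultimately show ?thesis by (simp add: p_def field_simps)
qed

text \<open>Negative correlation: all partners of x are equally likely, and if x is in the prefix, l
  - 1 partners are. So the average is l (l - 1) / (n (n - 1)) with n = |U|.\<close>

lemma perm_avg_prefix_mem2:
  assumes "finite U" "l \<le> card U" "x \<in> U" "y \<in> U" "x \<noteq> y"
  shows "perm_avg U (\<lambda>xs. of_bool (x \<in> set (take l xs)) * of_bool (y \<in> set (take l xs))) \<le> (real l / card U)\<^sup>2"
proof -
  define p where "p z = perm_avg U (\<lambda>xs. of_bool (x \<in> set (take l xs)) * of_bool (z \<in> set (take l xs)))" for z
  have "p z = p y" if "z \<in> U - {x}" for z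
  proof -
    have perm: "Transposition.transpose y z permutes U" using that assms by (intro permutes_swap_id) auto
    have fix_x: "Transposition.transpose y z x = x"
      using that assms by (auto simp: Transposition.transpose_def)
    from perm have "p z = perm_avg U (\<lambda>xs. of_bool (x \<in> set (take l (map (Transposition.transpose y z) xs)))
        * of_bool (z \<in> set (take l (map (Transposition.transpose y z) xs))))"
      unfolding p_def by (rule perm_avg_relabel[symmetric])
    also have "\<dots> = p y"
      unfolding p_def
      by (rule perm_avg_cong) (simp add: take_map mem_transpose_image fix_x)
    finally show ?thesis .
  qed
  then have "(\<Sum>z\<in>U - {x}. p z) = (\<Sum>z\<in>U - {x}. p y)" by (rule sum.cong[OF refl])
  moreover have "card (U - {x}) = card U - 1" "card U \<ge> 2"
    using assms card_mono[of U "{x, y}"] by auto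
  ultimately have "(real (card U) - 1) * p y = (\<Sum>z\<in>U - {x}. p z)"
    by (simp add: of_nat_diff)
  also have "\<dots> = perm_avg U (\<lambda>xs. \<Sum>z\<in>U - {x}. of_bool (x \<in> set (take l xs)) * of_bool (z \<in> set (take l xs)))"
    by (simp add: p_def perm_avg_sum)
  also have "\<dots> = perm_avg U (\<lambda>xs. (real l - 1) * of_bool (x \<in> set (take l xs)))"
  proof (rule perm_avg_cong)
    fix xs assume xs: "xs \<in> permutations_of_set U"
    show "(\<Sum>z\<in>U - {x}. of_bool (x \<in> set (take l xs)) * of_bool (z \<in> set (take l xs)))
        = (real l - 1) * of_bool (x \<in> set (take l xs))"
    proof (cases "x \<in> set (take l xs)")
      case True
      have "(\<Sum>z\<in>U - {x}. of_bool (z \<in> set (take l xs))) = real (card ((U - {x}) \<inter> set (take l xs)))"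
        using assms by (simp add: sum.If_cases of_bool_def Int_def)
      also have "(U - {x}) \<inter> set (take l xs) = set (take l xs) - {x}"
        using xs by (auto simp: permutations_of_set_def dest: in_set_takeD)
      also have "card (set (take l xs) - {x}) = card (set (take l xs)) - 1"
        using True by simp
      also have "card (set (take l xs)) = l"
        using xs assms length_finite_permutations_of_set[OF xs]
        by (simp add: permutations_of_set_def distinct_card)
      finally show ?thesis using True by (cases l) (auto simp: of_nat_diff)
    qed simp
  qed
  also have "\<dots> = (real l - 1) * (real l / card U)"
    using assms by (simp only: perm_avg_cmult perm_avg_prefix_mem)
  finally have "p y = (real l - 1) / (real (card U) - 1) * (real l / card U)"
    using \<open>card U \<ge> 2\<close> by (simp add: field_simps)
  also have "(real l - 1) / (real (card U) - 1) \<le> real l / card U"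
    using \<open>card U \<ge> 2\<close> assms(2) by (simp add: field_simps)
  then have "(real l - 1) / (real (card U) - 1) * (real l / card U) \<le> (real l / card U)\<^sup>2"
    unfolding power2_eq_square by (intro mult_right_mono) auto
  finally show ?thesis by (simp add: p_def)
qed

subsection \<open>The value of the greedy solution on a random prefix\<close>

context submodular_secretary
begin

text \<open>By diminishing returns, an item of \<open>R\<close> adds at least its marginal over the
  full prefix before it. The bound is linear in the membership indicators, so it can be averaged
  term by term.\<close>

lemma v_inter_ge_marginals:
  assumes "distinct xs" "set xs \<subseteq> U"
  shows "v {} + (\<Sum>i<length xs. of_bool (xs ! i \<in> R) * (v (set (take (Suc i) xs)) - v (set (take i xs))))
    \<le> v (set xs \<inter> R)"
  using assms
proof (induction xs rule: rev_induct)
  case (snoc x xs)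
  have "(\<Sum>i<length (xs @ [x]). of_bool ((xs @ [x]) ! i \<in> R)
        * (v (set (take (Suc i) (xs @ [x]))) - v (set (take i (xs @ [x])))))
      = (\<Sum>i<length xs. of_bool (xs ! i \<in> R) * (v (set (take (Suc i) xs)) - v (set (take i xs))))
        + of_bool (x \<in> R) * (v (insert x (set xs)) - v (set xs))"
    by (simp add: nth_append)
  moreover have "of_bool (x \<in> R) * (v (insert x (set xs)) - v (set xs)) \<le> v (set (xs @ [x]) \<inter> R) - v (set xs \<inter> R)"
    using marginal_antimono[of "set xs \<inter> R" "set xs" x] snoc.prems by (auto simp: Int_insert_left)
  ultimately show ?case using snoc by simp
qed simp

text \<open>\<open>greedy_k_ge\<close> is applied to the part of \<open>Q\<close> inside the prefix.
  \<open>v Q\<close> splits into \<open>v {}\<close> and nonnegative marginals \<open>d i\<close>,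
  and the average weight on each of them is at least \<open>q\<close>.\<close>

lemma perm_avg_greedy_prefix_ge:
  assumes Q: "Q \<subseteq> U" "card Q \<le> k" and l: "k \<le> l" "l \<le> card U"
  defines "x \<equiv> real l / card U"
  shows "x * (1 - x / exp 1 - 1 / (exp 1 * real k)) * v Q \<le> perm_avg U (\<lambda>xs. v (greedy_k (set (take l xs))))"
proof -
  define I :: "'a \<Rightarrow> 'a list \<Rightarrow> real" where "I y xs = of_bool (y \<in> set (take l xs))" for y xs
  define h :: "'a list \<Rightarrow> real" where "h xs = (\<Sum>y\<in>Q. I y xs)" for xs
  define w :: "'a list \<Rightarrow> real" where "w xs = 1 - 1 / (exp 1 * real k) * h xs" for xs
  define q where "q = x * (1 - x / exp 1 - 1 / (exp 1 * real k))"
  have finQ: "finite Q" using Q finU finite_subset by blast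
  obtain qs where qs: "set qs = Q" "distinct qs" using finite_distinct_list[OF finQ] by blast
  define d where "d i = v (set (take (Suc i) qs)) - v (set (take i qs))" for i
  have take_sub: "set (take i qs) \<subseteq> U" for i using set_take_subset[of i qs] qs Q by blast
  have d_nonneg: "0 \<le> d i" for i
    unfolding d_def using v_mono[OF set_take_subset_set_take take_sub, of i "Suc i"] by simp
  have e: "exp (1::real) \<ge> 1" by simp
  have k: "real k \<ge> 1" using k_pos by simp
  have x: "0 \<le> x" "x \<le> 1" using l k_pos unfolding x_def by (auto simp: divide_simps)
  have h_card: "h xs = card (Q \<inter> set (take l xs))" for xs
    unfolding h_def I_def using finQ by (simp add: sum.If_cases of_bool_def Int_def)
  have w_nonneg: "0 \<le> w xs" for xs
  proof -
    have "card (Q \<inter> set (take l xs)) \<le> card Q" using finQ by (intro card_mono) auto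
    then have "h xs \<le> k" using Q(2) by (simp add: h_card)
    also have "\<dots> \<le> exp 1 * k" using mult_right_mono[OF e, of k] by simp
    finally show ?thesis using k by (simp add: w_def)
  qed
  have avg_I: "perm_avg U (I y) = x" if "y \<in> U" for y
    using perm_avg_prefix_mem[OF finU l(2) that] unfolding I_def x_def .
  have avg_II: "perm_avg U (\<lambda>xs. I y xs * I z xs) \<le> x\<^sup>2" if "y \<in> U" "z \<in> U" "y \<noteq> z" for y z
    using perm_avg_prefix_mem2[OF finU l(2) that] unfolding I_def x_def .
  have avg_w: "q \<le> perm_avg U w"
  proof -
    have avg: "perm_avg U w = 1 - 1 / (exp 1 * real k) * (\<Sum>y\<in>Q. perm_avg U (I y))"
      unfolding w_def h_def
      by (simp only: perm_avg_diff perm_avg_const[OF finU] perm_avg_cmult perm_avg_sum)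
    have "(\<Sum>y\<in>Q. perm_avg U (I y)) = (\<Sum>y\<in>Q. x)"
      using avg_I Q by (intro sum.cong) auto
    also have "\<dots> \<le> real k * x" using Q(2) x by (simp add: mult_right_mono)
    finally have "1 - 1 / (exp 1 * real k) * (real k * x) \<le> perm_avg U w"
      unfolding avg by (intro diff_left_mono mult_left_mono) auto
    moreover have "1 / (exp 1 * real k) * (real k * x) = x / exp 1" using k by simp
    moreover have "q \<le> 1 - x / exp 1"
    proof -
      have "x / exp 1 \<le> 1" using x e by (simp add: order_trans)
      have "q \<le> x * (1 - x / exp 1)"
        unfolding q_def using x k by (intro mult_left_mono) auto
      also have "\<dots> \<le> 1 * (1 - x / exp 1)"
        using x \<open>x / exp 1 \<le> 1\<close> by (intro mult_right_mono) auto
      finally show ?thesis by simp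
    qed
    ultimately show ?thesis by simp
  qed
  \<comment> \<open>The diagonal product of \<open>I y\<close> with itself is \<open>I y\<close> and
    causes the loss 1 / (e k). The at most k other products contribute at most x^2 each.\<close>
  have avg_wI: "q \<le> perm_avg U (\<lambda>xs. w xs * I y xs)" if y: "y \<in> Q" for y
  proof -
    have yU: "y \<in> U" using y Q by blast
    have "(\<lambda>xs. w xs * I y xs) = (\<lambda>xs. I y xs - 1 / (exp 1 * real k) * (I y xs + (\<Sum>z\<in>Q - {y}. I y xs * I z xs)))"
    proof
      fix xs
      have "h xs = I y xs + (\<Sum>z\<in>Q - {y}. I z xs)"
        unfolding h_def using finQ y by (rule sum.remove)
      then have "h xs * I y xs = I y xs * I y xs + (\<Sum>z\<in>Q - {y}. I y xs * I z xs)"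
        by (simp only: distrib_right sum_distrib_right) (simp only: mult.commute)
      also have "I y xs * I y xs = I y xs" by (simp add: I_def)
      finally have "h xs * I y xs = I y xs + (\<Sum>z\<in>Q - {y}. I y xs * I z xs)" .
      then show "w xs * I y xs = I y xs - 1 / (exp 1 * real k) * (I y xs + (\<Sum>z\<in>Q - {y}. I y xs * I z xs))"
        by (simp add: w_def left_diff_distrib)
    qed
    then have "perm_avg U (\<lambda>xs. w xs * I y xs)
        = x - 1 / (exp 1 * real k) * (x + (\<Sum>z\<in>Q - {y}. perm_avg U (\<lambda>xs. I y xs * I z xs)))"
      by (simp only: perm_avg_diff perm_avg_cmult perm_avg_add perm_avg_sum avg_I[OF yU])
    moreover have "(\<Sum>z\<in>Q - {y}. perm_avg U (\<lambda>xs. I y xs * I z xs)) \<le> (\<Sum>z\<in>Q - {y}. x\<^sup>2)"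
      using Q yU by (intro sum_mono avg_II) auto
    moreover have "(\<Sum>z\<in>Q - {y}. x\<^sup>2) \<le> real k * x\<^sup>2"
    proof -
      have "card (Q - {y}) \<le> k" using Q(2) card_Diff1_le[of Q y] by linarith
      then show ?thesis by (simp add: mult_right_mono)
    qed
    ultimately have "x - 1 / (exp 1 * real k) * (x + real k * x\<^sup>2) \<le> perm_avg U (\<lambda>xs. w xs * I y xs)"
      using k by (simp add: divide_right_mono)
    moreover have "x - 1 / (exp 1 * real k) * (x + real k * x\<^sup>2) = q"
      unfolding q_def using k by (simp add: field_simps power2_eq_square)
    ultimately show ?thesis by simp
  qed
  have "(\<Sum>i<length qs. d i) = v Q - v {}"
    unfolding d_def using sum_lessThan_telescope[of "\<lambda>i. v (set (take i qs))" "length qs"] qs by simp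
  then have "q * v Q = q * v {} + (\<Sum>i<length qs. q * d i)"
    by (simp add: sum_distrib_left[symmetric] right_diff_distrib)
  also have "\<dots> \<le> perm_avg U w * v {} + (\<Sum>i<length qs. perm_avg U (\<lambda>xs. w xs * I (qs ! i) xs) * d i)"
    using avg_w v_nonneg[of "{}"] d_nonneg qs
    by (intro add_mono mult_right_mono sum_mono avg_wI) auto
  also have "\<dots> = perm_avg U (\<lambda>xs. v {} * w xs + (\<Sum>i<length qs. d i * (w xs * I (qs ! i) xs)))"
    by (simp only: perm_avg_add perm_avg_sum perm_avg_cmult mult.commute)
  also have "\<dots> \<le> perm_avg U (\<lambda>xs. v (greedy_k (set (take l xs))))"
  proof (rule perm_avg_mono)
    fix xs assume xs: "xs \<in> permutations_of_set U"
    have sub: "set (take l xs) \<subseteq> U"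
      using xs by (auto simp: permutations_of_set_def dest: in_set_takeD)
    have card: "card (set (take l xs)) = l"
      using xs l length_finite_permutations_of_set[OF xs]
      by (simp add: permutations_of_set_def distinct_card)
    have "v {} * w xs + (\<Sum>i<length qs. d i * (w xs * I (qs ! i) xs))
        = w xs * (v {} + (\<Sum>i<length qs. I (qs ! i) xs * d i))"
      by (simp add: distrib_left sum_distrib_left mult_ac)
    also have "\<dots> \<le> w xs * v (Q \<inter> set (take l xs))"
      using v_inter_ge_marginals[OF qs(2), of "set (take l xs)"] qs Q w_nonneg
      by (intro mult_left_mono) (auto simp: I_def d_def)
    also have "\<dots> = (1 - real (card (Q \<inter> set (take l xs))) / (exp 1 * real k)) * v (Q \<inter> set (take l xs))"
      by (simp add: w_def h_card)
    also have "\<dots> \<le> v (greedy_k (set (take l xs)))"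
      using sub card l by (intro greedy_k_ge) auto
    finally show "v {} * w xs + (\<Sum>i<length qs. d i * (w xs * I (qs ! i) xs)) \<le> v (greedy_k (set (take l xs)))" .
  qed
  finally show ?thesis by (simp add: q_def)
qed

end

subsection \<open>Backward recursion for the value of Algorithm 1\<close>

text \<open>Acceptance without an accumulator: the past enters only through the capacity
  \<open>c\<close>, which suits a recursion running backwards in time.\<close>

primrec picks :: "('a set \<Rightarrow> 'a set) \<Rightarrow> 'a list \<Rightarrow> nat list \<Rightarrow> nat \<Rightarrow> 'a set" where
  "picks g xs [] c = {}"
| "picks g xs (l # ls) c =
     (if xs ! (l - 1) \<in> g (set (take l xs)) \<and> 0 < c
      then insert (xs ! (l - 1)) (picks g xs ls (c - 1)) else picks g xs ls c)"

lemma picks_subset: "picks g xs ls c \<subseteq> (\<lambda>l. xs ! (l - 1)) ` set ls"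
proof (induction ls arbitrary: c)
  case (Cons l ls)
  show ?case using Cons[of c] Cons[of "c - 1"] by auto
qed simp

text \<open>Reordering earlier arrivals therefore does not affect the picks of later rounds.\<close>

lemma picks_cong:
  assumes "\<And>l. l \<in> set ls \<Longrightarrow> xs ! (l - 1) = ys ! (l - 1) \<and> set (take l xs) = set (take l ys)"
  shows "picks g xs ls c = picks g ys ls c"
  using assms by (induction ls arbitrary: c) simp_all

text \<open>The accumulator influences decisions only through its size. Distinct arrivals outside
  \<open>A\<close> ensure that each acceptance uses exactly one unit of capacity.\<close>

lemma foldl_alg1_round:
  assumes "finite A" "distinct (map (\<lambda>l. xs ! (l - 1)) ls)" "A \<inter> (\<lambda>l. xs ! (l - 1)) ` set ls = {}"
  shows "foldl (alg1_round v tb k xs) A ls = A \<union> picks (greedy v tb k) xs ls (k - card A)"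
  using assms
proof (induction ls arbitrary: A)
  case (Cons l ls)
  define j where "j = xs ! (l - 1)"
  have IH: "foldl (alg1_round v tb k xs) B ls = B \<union> picks (greedy v tb k) xs ls (k - card B)"
    if "finite B" "B \<subseteq> insert j A" for B
  proof (rule Cons.IH)
    have "j \<notin> (\<lambda>l. xs ! (l - 1)) ` set ls" "A \<inter> (\<lambda>l. xs ! (l - 1)) ` set ls = {}"
      using Cons.prems by (auto simp: j_def)
    then show "B \<inter> (\<lambda>l. xs ! (l - 1)) ` set ls = {}" using that(2) by blast
  qed (use Cons.prems that in auto)
  have "j \<notin> A" using Cons.prems by (auto simp: j_def)
  then have "foldl (alg1_round v tb k xs) (insert j A) ls
      = insert j (A \<union> picks (greedy v tb k) xs ls (k - card A - 1))"
    using IH[of "insert j A"] Cons.prems(1) by simp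
  moreover have "foldl (alg1_round v tb k xs) A ls = A \<union> picks (greedy v tb k) xs ls (k - card A)"
    using IH[of A] Cons.prems(1) by auto
  moreover have "alg1_round v tb k xs A l
      = (if j \<in> greedy v tb k (set (take l xs)) \<and> card A < k then insert j A else A)"
    by (simp add: alg1_round_def Let_def j_def)
  ultimately show ?case unfolding picks.simps foldl.simps j_def[symmetric] by simp
qed simp

text \<open>Rounds count from 1 and list positions from 0; starting at 1 keeps the truncated
  \<open>l - 1\<close> injective.\<close>

lemma nth_pred_inj_on:
  assumes "distinct xs"
  shows "inj_on (\<lambda>l. xs ! (l - 1)) {1..length xs}"
proof (rule inj_onI)
  fix a b assume "a \<in> {1..length xs}" "b \<in> {1..length xs}" "xs ! (a - 1) = xs ! (b - 1)"
  then have "a - 1 = b - 1" "a \<ge> 1" "b \<ge> 1"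
    using nth_eq_iff_index_eq[OF assms, of "a - 1" "b - 1"] by auto
  then show "a = b" by linarith
qed

lemma alg1_eq_picks:
  assumes "distinct xs"
  shows "alg1 p v tb k xs
    = picks (greedy v tb k) xs [max 1 (nat \<lceil>p * real (length xs)\<rceil>)..<Suc (length xs)] k"
proof -
  let ?ls = "[max 1 (nat \<lceil>p * real (length xs)\<rceil>)..<Suc (length xs)]"
  have "inj_on (\<lambda>l. xs ! (l - 1)) (set ?ls)"
    using nth_pred_inj_on[OF assms] by (rule inj_on_subset) auto
  then have "distinct (map (\<lambda>l. xs ! (l - 1)) ?ls)"
    by (simp only: distinct_map distinct_upt simp_thms)
  then show ?thesis
    unfolding alg1_def by (subst foldl_alg1_round) auto
qed

text \<open>Conditioned on the set of the first \<open>l\<close> items and on the order of the later ones, the item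
  of round \<open>l\<close> is uniform in that set.\<close>

lemma perm_avg_resample_round:
  assumes "1 \<le> l" "l \<le> card U"
  shows "real l * perm_avg U f
    = perm_avg U (\<lambda>xs. \<Sum>i<l. f (permute_list (Transposition.transpose i (l - 1)) xs))"
proof -
  have "perm_avg U (\<lambda>xs. f (permute_list (Transposition.transpose i (l - 1)) xs)) = perm_avg U f" if "i < l" for i
    using that assms by (intro perm_avg_permute_positions permutes_swap_id) auto
  then have "(\<Sum>i<l. perm_avg U (\<lambda>xs. f (permute_list (Transposition.transpose i (l - 1)) xs))) = (\<Sum>i<l. perm_avg U f)"
    by (intro sum.cong) auto
  then show ?thesis by (simp add: perm_avg_sum)
qed

text \<open>The swap acts within the first \<open>l\<close> positions, so rounds from
  \<open>l\<close> on notice only who arrives in round \<open>l\<close> itself.\<close>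

lemma permute_list_transpose_prefix:
  assumes "i < l" "l \<le> length xs" "1 \<le> l"
  defines "ys \<equiv> permute_list (Transposition.transpose i (l - 1)) xs"
  shows "ys ! (l - 1) = xs ! i"
    and "l \<le> l' \<Longrightarrow> set (take l' ys) = set (take l' xs)"
    and "l < l' \<Longrightarrow> l' \<le> length xs \<Longrightarrow> ys ! (l' - 1) = xs ! (l' - 1)"
proof -
  let ?t = "Transposition.transpose i (l - 1)"
  have perm: "?t permutes {..<m}" if "l \<le> m" for m
    using that assms by (intro permutes_swap_id) auto
  note nth = permute_list_nth[OF perm[OF assms(2)]]
  show "ys ! (l - 1) = xs ! i" unfolding ys_def using assms(1-3) by (subst nth) auto
  show "ys ! (l' - 1) = xs ! (l' - 1)" if "l < l'" "l' \<le> length xs"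
    unfolding ys_def using assms(1-3) that by (subst nth) (auto simp: Transposition.transpose_def)
  show "set (take l' ys) = set (take l' xs)" if "l \<le> l'"
  proof (cases "l' \<le> length xs")
    case True
    have "set (take l' ys) = (!) ys ` {0..<l'}"
      using True by (intro nth_image[symmetric]) (simp add: ys_def)
    also have "\<dots> = (\<lambda>j. xs ! (?t j)) ` {0..<l'}"
      using True unfolding ys_def by (intro image_cong refl nth) auto
    also have "\<dots> = (!) xs ` (?t ` {..<l'})" by (simp add: image_image lessThan_atLeast0)
    also have "?t ` {..<l'} = {0..<l'}" using permutes_image[OF perm[OF that]] by (simp add: lessThan_atLeast0)
    also have "(!) xs ` {0..<l'} = set (take l' xs)"
      using True by (rule nth_image)
    finally show ?thesis .
  next
    case False
    then show ?thesis unfolding ys_def using perm[OF assms(2)] by simp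
  qed
qed

context submodular_secretary
begin

text \<open>The average runs over entire orders, with capacity \<open>c\<close> prescribed at round
  \<open>l\<close> whatever happened before.\<close>

definition remaining_value :: "nat \<Rightarrow> nat \<Rightarrow> real" where
  "remaining_value l c = perm_avg U (\<lambda>xs. v (picks greedy_k xs [l..<Suc (card U)] c))"

lemma expected_alg1_eq_remaining_value:
  "expected_alg1 p U v tb k = remaining_value (max 1 (nat \<lceil>p * real (card U)\<rceil>)) k"
  unfolding expected_alg1_def remaining_value_def expectation_perm_eq_avg[OF finU]
  by (rule perm_avg_cong)
    (simp add: alg1_eq_picks permutations_of_setD length_finite_permutations_of_set greedy_k_def del: upt_Suc)

lemma picks_subset_U:
  assumes "xs \<in> permutations_of_set U" "1 \<le> l"
  shows "picks g xs [l..<Suc (card U)] c \<subseteq> U"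
proof -
  have "(\<lambda>l. xs ! (l - 1)) ` set [l..<Suc (card U)] \<subseteq> U"
  proof (rule image_subsetI)
    fix l' assume "l' \<in> set [l..<Suc (card U)]"
    then have "l \<le> l'" "l' \<le> card U" by (simp_all del: upt_Suc)
    then have "l' - 1 < length xs"
      using assms(2) unfolding length_finite_permutations_of_set[OF assms(1)] by linarith
    then have "xs ! (l' - 1) \<in> set xs" by (rule nth_mem)
    then show "xs ! (l' - 1) \<in> U" by (simp only: permutations_of_setD(1)[OF assms(1)])
  qed
  with picks_subset show ?thesis by (rule order_trans)
qed

lemma remaining_value_nonneg: "1 \<le> l \<Longrightarrow> 0 \<le> remaining_value l c"
  using perm_avg_mono[of U "\<lambda>_. 0", OF v_nonneg[OF picks_subset_U]]
  unfolding remaining_value_def perm_avg_const[OF finU] .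

text \<open>Of the l equally likely items of round l, the k in the greedy solution \<open>S\<close>
  are accepted and leave capacity c; the others leave capacity c + 1.\<close>

lemma remaining_value_recursion:
  assumes l: "k \<le> l" "l \<le> card U"
  shows "(real l - real k) * remaining_value (Suc l) (Suc c) + (real k - 1) * remaining_value (Suc l) c
      + perm_avg U (\<lambda>xs. v (greedy_k (set (take l xs)))) \<le> real l * remaining_value l (Suc c)"
proof -
  let ?P = "\<lambda>xs c. picks greedy_k xs [Suc l..<Suc (card U)] c"
  have l1: "1 \<le> l" using l k_pos by simp
  have upt: "[l..<Suc (card U)] = l # [Suc l..<Suc (card U)]" using l by (simp add: upt_conv_Cons)
  have "(real l - real k) * remaining_value (Suc l) (Suc c) + (real k - 1) * remaining_value (Suc l) c
      + perm_avg U (\<lambda>xs. v (greedy_k (set (take l xs))))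
      = perm_avg U (\<lambda>xs. (real l - real k) * v (?P xs (Suc c)) + (real k - 1) * v (?P xs c) + v (greedy_k (set (take l xs))))"
    unfolding remaining_value_def by (simp only: perm_avg_add perm_avg_cmult)
  also have "\<dots> \<le> perm_avg U (\<lambda>xs. \<Sum>i<l. v (picks greedy_k (permute_list (Transposition.transpose i (l - 1)) xs) [l..<Suc (card U)] (Suc c)))"
  proof (rule perm_avg_mono)
    fix xs assume xs: "xs \<in> permutations_of_set U"
    have len: "length xs = card U" using length_finite_permutations_of_set[OF xs] .
    have dist: "distinct xs" and set_xs: "set xs = U" using permutations_of_setD[OF xs] by auto
    define L where "L = set (take l xs)"
    define S where "S = greedy_k L"
    define B where "B = ?P xs c"
    define C where "C = ?P xs (Suc c)"
    have L: "L \<subseteq> U" "finite L" "card L = l"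
      using set_xs l len dist by (auto simp: L_def distinct_card dest: in_set_takeD)
    have S: "S \<subseteq> L" "card S = k" using greedy_k_subset_card[OF L(2)] L(3) l by (auto simp: S_def)
    have BU: "B \<subseteq> U" unfolding B_def using xs by (rule picks_subset_U) simp
    \<comment> \<open>The later picks \<open>B\<close> and \<open>C\<close> are the same for every
      i, because the swap leaves later items and prefix sets unchanged.\<close>
    have split: "v (picks greedy_k (permute_list (Transposition.transpose i (l - 1)) xs) [l..<Suc (card U)] (Suc c))
        = (if xs ! i \<in> S then v (insert (xs ! i) B) else v C)" if i: "i < l" for i
    proof -
      let ?ys = "permute_list (Transposition.transpose i (l - 1)) xs"
      have "l \<le> length xs" using l len by simp
      note * = permute_list_transpose_prefix[OF i this l1]
      have "?P ?ys c = ?P xs c" for c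
      proof (rule picks_cong)
        fix l' assume "l' \<in> set [Suc l..<Suc (card U)]"
        then have "l < l'" "l' \<le> length xs" using len by (auto simp del: upt_Suc)
        then show "?ys ! (l' - 1) = xs ! (l' - 1) \<and> set (take l' ?ys) = set (take l' xs)"
          using *(2,3)[of l'] by simp
      qed
      then show ?thesis
        using *(1) *(2)[OF order_refl] unfolding upt by (simp add: S_def L_def B_def C_def)
    qed
    have "bij_betw ((!) (take l xs)) {..<l} L"
      using dist l len by (intro bij_betw_nth) (simp_all add: L_def)
    then have bij: "bij_betw ((!) xs) {..<l} L"
      by (rule bij_betw_cong[THEN iffD1, rotated]) simp
    have "(\<Sum>i<l. v (picks greedy_k (permute_list (Transposition.transpose i (l - 1)) xs) [l..<Suc (card U)] (Suc c)))
        = (\<Sum>i<l. if xs ! i \<in> S then v (insert (xs ! i) B) else v C)"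
      by (rule sum.cong[OF refl], rule split) simp
    also have "\<dots> = (\<Sum>x\<in>L. if x \<in> S then v (insert x B) else v C)"
      by (rule sum.reindex_bij_betw[OF bij])
    also have "\<dots> = (\<Sum>x\<in>S. v (insert x B)) + (\<Sum>x\<in>L - S. v C)"
      using L(2) S(1) by (simp add: sum.If_cases Int_absorb1 Diff_eq)
    also have "(\<Sum>x\<in>L - S. v C) = (real l - real k) * v C"
      using S L l finite_subset[OF S(1) L(2)] by (simp add: card_Diff_subset of_nat_diff)
    also have "(\<Sum>x\<in>S. v (insert x B)) = (\<Sum>x\<in>S. v (insert x B) - v B) + real k * v B"
      using S(2) by (simp add: sum_subtractf)
    finally have "(\<Sum>i<l. v (picks greedy_k (permute_list (Transposition.transpose i (l - 1)) xs) [l..<Suc (card U)] (Suc c)))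
        = (\<Sum>x\<in>S. v (insert x B) - v B) + real k * v B + (real l - real k) * v C" .
    \<comment> \<open>Of the k copies of \<open>v B\<close> one is spent here to gain
      \<open>v S\<close>; hence the coefficient k - 1.\<close>
    moreover have "v (S \<union> B) - v B \<le> (\<Sum>x\<in>S. v (insert x B) - v B)"
      using S L BU by (intro sum_marginals_ge) auto
    moreover have "v S \<le> v (S \<union> B)" using S L BU by (intro v_mono) auto
    ultimately show "(real l - real k) * v (?P xs (Suc c)) + (real k - 1) * v (?P xs c) + v (greedy_k (set (take l xs)))
      \<le> (\<Sum>i<l. v (picks greedy_k (permute_list (Transposition.transpose i (l - 1)) xs) [l..<Suc (card U)] (Suc c)))"
      by (simp only: B_def[symmetric] C_def[symmetric] L_def[symmetric] S_def[symmetric] left_diff_distrib)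
  qed
  also have "\<dots> = real l * remaining_value l (Suc c)"
    unfolding remaining_value_def using l1 l(2) by (rule perm_avg_resample_round[symmetric])
  finally show ?thesis .
qed

end

subsection \<open>Solving the recursion\<close>

context submodular_secretary
begin

text \<open>Divided by \<open>l - 1\<close>, the recursion becomes that of a Markov chain which loses one unit of capacity
  in round \<open>l\<close> with probability \<open>(k - 1) / (l - 1)\<close>. The number of losses is stochastically dominated by a
  Poisson variable, whose mean is chosen such that it telescopes; hence the shifts by \<open>k + 1\<close> inside
  the logarithms.\<close>

lemma remaining_value_ge_sum:
  assumes k2: "k \<ge> 2" and Q: "Q \<subseteq> U" "card Q \<le> k"
    and l: "k + 2 \<le> l" "l \<le> Suc (card U)"
  defines "s \<equiv> \<lambda>i. (1 - real i / card U / exp 1 - 1 / (exp 1 * k)) / (card U * (real i - 1))"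
  shows "(real l - 1) * (\<Sum>i=l..card U. s i * pois_cdf c ((real k - 1) * (ln (real i - k - 1) - ln (real l - k - 1)))) * v Q
    \<le> remaining_value l c"
  using l
proof (induction arbitrary: c rule: inc_induct[OF l(2)])
  case 1
  then show ?case using remaining_value_nonneg[of "Suc (card U)" c] by simp
next
  case (2 l)
  show ?case
  proof (cases c)
    case 0
    then show ?thesis using remaining_value_nonneg[of l c] 2 by simp
  next
    case (Suc b)
    define n where "n = real (card U)"
    define m where "m = real k - 1"
    define y where "y = real l - k"
    \<comment> \<open>Capacity survives a round with probability y / (y + m). A mean of ln (1 + m /
      y) would dominate this loss; the slightly larger \<open>\<mu>\<close> telescopes. Adding it to
      \<open>\<Lambda> i\<close> moves the starting round from l + 1 back to l.\<close>
    define \<mu> where "\<mu> = m * (ln y - ln (y - 1))"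
    define \<Lambda> where "\<Lambda> i = m * (ln (real i - k - 1) - ln y)" for i
    have ln: "l \<le> card U" using 2 by simp
    have y: "y \<ge> 2" using 2 by (simp add: y_def)
    have m: "m \<ge> 1" using k2 by (simp add: m_def)
    have lm: "real l - 1 = y + m" by (simp add: y_def m_def)
    have "1 / y \<le> ln (y / (y - 1))"
    proof -
      have "ln ((y - 1) / y) \<le> (y - 1) / y - 1" using y by (intro ln_le_minus_one) simp
      moreover have "(y - 1) / y - 1 = - (1 / y)" using y by (simp add: diff_divide_distrib)
      moreover have "ln ((y - 1) / y) = - ln (y / (y - 1))" using y by (simp add: ln_div)
      ultimately show ?thesis by linarith
    qed
    then have "m * (1 / y) \<le> \<mu>"
      using m y unfolding \<mu>_def by (intro mult_left_mono) (simp_all add: ln_div)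
    then have \<mu>: "m / y \<le> \<mu>" by simp
    have "0 \<le> m / y" using m y by simp
    then have \<mu>0: "0 \<le> \<mu>" using \<mu> by linarith
    have "1 + m / y \<le> exp \<mu>" using exp_ge_add_one_self[of \<mu>] \<mu> by linarith
    then have "exp (-\<mu>) \<le> 1 / (1 + m / y)"
      using m y unfolding exp_minus inverse_eq_divide
      by (intro divide_left_mono mult_pos_pos add_pos_nonneg) auto
    also have "\<dots> = y / (y + m)" using m y by (simp add: field_simps)
    finally have exp_\<mu>: "exp (-\<mu>) \<le> y / (y + m)" .
    \<comment> \<open>Raising the weight of the larger capacity from \<open>exp (-\<mu>)\<close> to
      y / (y + m) is allowed, since \<open>pois_cdf\<close> grows with the capacity.\<close>
    have drift: "(y + m) * pois_cdf (Suc b) (x + \<mu>) \<le> y * pois_cdf (Suc b) x + m * pois_cdf b x" if "x \<ge> 0" for x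
    proof -
      have "pois_cdf (Suc b) (x + \<mu>) \<le> pois_cdf b x + exp (-\<mu>) * pois b x"
        using pois_cdf_add_le[OF that \<mu>0, of b] by (simp add: pois_cdf_Suc algebra_simps)
      also have "\<dots> \<le> pois_cdf b x + y / (y + m) * pois b x"
        using exp_\<mu> pois_nonneg[OF that] by (intro add_left_mono mult_right_mono)
      finally have "(y + m) * pois_cdf (Suc b) (x + \<mu>) \<le> (y + m) * (pois_cdf b x + y / (y + m) * pois b x)"
        using m y by (intro mult_left_mono) auto
      also have "\<dots> = y * pois_cdf (Suc b) x + m * pois_cdf b x"
        using m y by (simp add: pois_cdf_Suc field_simps)
      finally show ?thesis .
    qed
    have s_nonneg: "0 \<le> s i" if "l < i" "i \<le> card U" for i
    proof -
      have "real i / card U \<le> 1" using that by simp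
      then have "real i / card U / exp 1 \<le> 1 / 2"
        using exp1_gt_2 by (intro frac_le) simp_all
      moreover have "1 / (exp 1 * real k) \<le> 1 / (2 * 2)"
        using exp1_gt_2 k2 by (intro divide_left_mono mult_mono) auto
      ultimately have "0 \<le> 1 - real i / card U / exp 1 - 1 / (exp 1 * real k)" by linarith
      then show ?thesis unfolding s_def by (rule divide_nonneg_nonneg) (use that in simp)
    qed
    have IH: "real l * (\<Sum>i=Suc l..card U. s i * pois_cdf c (\<Lambda> i)) * v Q \<le> remaining_value (Suc l) c" for c
      using "2.IH"[of c] 2 by (simp add: \<Lambda>_def y_def m_def)
    have \<Lambda>_nonneg: "0 \<le> \<Lambda> i" if "l < i" for i
    proof -
      have "real i \<ge> real l + 1" using that by simp
      then show ?thesis using that y m unfolding \<Lambda>_def y_def by simp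
    qed
    \<comment> \<open>\<open>s l\<close> is the greedy bound of round l divided by l (l - 1): one
      factor comes from the recursion, the other from the normalisation by l - 1.\<close>
    have greedy: "real l * (real l - 1) * s l * v Q \<le> perm_avg U (\<lambda>xs. v (greedy_k (set (take l xs))))"
    proof -
      have "real l * (real l - 1) * s l = real l / n * (1 - real l / n / exp 1 - 1 / (exp 1 * k))"
        using 2 by (simp add: s_def n_def)
      then show ?thesis
        using perm_avg_greedy_prefix_ge[OF Q, of l] 2 ln by (simp add: n_def)
    qed
    have "(\<Sum>i=Suc l..card U. s i * ((y + m) * pois_cdf (Suc b) (\<Lambda> i + \<mu>)))
        \<le> (\<Sum>i=Suc l..card U. s i * (y * pois_cdf (Suc b) (\<Lambda> i) + m * pois_cdf b (\<Lambda> i)))"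
      using s_nonneg drift \<Lambda>_nonneg by (intro sum_mono mult_left_mono) auto
    also have "\<dots> = y * (\<Sum>i=Suc l..card U. s i * pois_cdf (Suc b) (\<Lambda> i)) + m * (\<Sum>i=Suc l..card U. s i * pois_cdf b (\<Lambda> i))"
      by (simp add: sum_distrib_left sum.distrib algebra_simps)
    finally have "(y + m) * (\<Sum>i=Suc l..card U. s i * pois_cdf (Suc b) (\<Lambda> i + \<mu>))
        \<le> y * (\<Sum>i=Suc l..card U. s i * pois_cdf (Suc b) (\<Lambda> i)) + m * (\<Sum>i=Suc l..card U. s i * pois_cdf b (\<Lambda> i))"
      by (simp add: sum_distrib_left mult_ac)
    then have "(y + m) * (\<Sum>i=Suc l..card U. s i * pois_cdf (Suc b) (\<Lambda> i + \<mu>)) * (real l * v Q)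
        \<le> (y * (\<Sum>i=Suc l..card U. s i * pois_cdf (Suc b) (\<Lambda> i)) + m * (\<Sum>i=Suc l..card U. s i * pois_cdf b (\<Lambda> i))) * (real l * v Q)"
      using v_nonneg[OF Q(1)] by (intro mult_right_mono) auto
    also have "\<dots> = y * (real l * (\<Sum>i=Suc l..card U. s i * pois_cdf (Suc b) (\<Lambda> i)) * v Q)
        + m * (real l * (\<Sum>i=Suc l..card U. s i * pois_cdf b (\<Lambda> i)) * v Q)"
      by (simp add: algebra_simps)
    also have "\<dots> \<le> y * remaining_value (Suc l) (Suc b) + m * remaining_value (Suc l) b"
      using IH y m by (intro add_mono mult_left_mono) auto
    finally have "real l * ((real l - 1) * (s l + (\<Sum>i=Suc l..card U. s i * pois_cdf (Suc b) (\<Lambda> i + \<mu>))) * v Q)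
        \<le> y * remaining_value (Suc l) (Suc b) + m * remaining_value (Suc l) b + perm_avg U (\<lambda>xs. v (greedy_k (set (take l xs))))"
      using greedy unfolding lm by (simp add: algebra_simps)
    also have "\<dots> \<le> real l * remaining_value l (Suc b)"
      unfolding y_def m_def using 2 ln by (intro remaining_value_recursion) auto
    finally have "(real l - 1) * (s l + (\<Sum>i=Suc l..card U. s i * pois_cdf (Suc b) (\<Lambda> i + \<mu>))) * v Q \<le> remaining_value l (Suc b)"
      using 2 by (simp add: mult_le_cancel_left)
    moreover have "\<Lambda> i + \<mu> = (real k - 1) * (ln (real i - k - 1) - ln (real l - k - 1))" for i
      by (simp add: \<Lambda>_def \<mu>_def m_def y_def algebra_simps)
    \<comment> \<open>At i = l the mean is zero, and the positive capacity is certainly still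
      available.\<close>
    moreover have "(\<Sum>i=l..card U. s i * pois_cdf c ((real k - 1) * (ln (real i - k - 1) - ln (real l - k - 1))))
      = s l + (\<Sum>i=Suc l..card U. s i * pois_cdf c ((real k - 1) * (ln (real i - k - 1) - ln (real l - k - 1))))"
      using ln Suc by (simp add: sum.atLeast_Suc_atMost)
    ultimately show ?thesis using Suc by simp
  qed
qed

end

section \<open>From the sum to an integral\<close>

text \<open>The grid u i = ln ((i - k - 1) / (l - k - 1)) has spacing at most 1 / (i - k - 1), so
  the sum dominates a left Riemann sum of a decreasing function. The shift by k + 1 costs the terms
  (k + 1) / n.\<close>

lemma sum_ge_integral:
  fixes n k l :: nat
  assumes k: "k \<ge> 2" and l: "k + 2 \<le> l" "l \<le> n" "real n / exp 1 \<le> l" "real l - 1 \<le> n / exp 1"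
  defines "s \<equiv> \<lambda>i. (1 - real i / n / exp 1 - 1 / (exp 1 * k)) / (n * (real i - 1))"
  shows "(1 / exp 1 - (k + 1) / n)
      * (integral {0..1} (\<lambda>t. max 0 (1 - exp (t - 2) - 1 / (exp 1 * k) - (k + 1) / n) * pois_cdf k ((real k - 1) * t)))
    \<le> (real l - 1) * (\<Sum>i=l..n. s i * pois_cdf k ((real k - 1) * (ln (real i - k - 1) - ln (real l - k - 1))))"
proof -
  define M where "M = real l - k - 1"
  define u where "u i = ln (real i - k - 1) - ln M" for i :: nat
  \<comment> \<open>Truncation at 0 makes the integrand nonnegative, so extending the interval
    beyond 1 can only increase the integral.\<close>
  define g where "g t = max 0 (1 - exp (t - 2) - 1 / (exp 1 * k) - (k + 1) / n)" for t :: real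
  define h where "h t = g t * pois_cdf k ((real k - 1) * t)" for t
  have M: "M \<ge> 1" using l by (simp add: M_def)
  have n: "real n > 0" using l by simp
  have mono_u: "u i \<le> u (Suc i)" if "l \<le> i" for i
    using that M unfolding u_def M_def by simp
  have u_l: "u l = 0" by (simp add: u_def M_def)
  have u_nonneg: "0 \<le> u i" if "l \<le> i" for i
    using that M unfolding u_def M_def by simp
  have "1 \<le> u (Suc n)"
  proof -
    have "M * exp 1 \<le> (n / exp 1 - k) * exp 1" using l by (intro mult_right_mono) (auto simp: M_def)
    also have "\<dots> = n - k * exp 1" by (simp add: left_diff_distrib)
    also have "\<dots> \<le> real n - k" using mult_left_mono[of 1 "exp 1" "real k"] by simp
    finally have "exp 1 \<le> (real n - k) / M" using M by (simp add: pos_le_divide_eq mult.commute)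
    then have "1 \<le> ln ((real n - k) / M)"
      using ln_ge_iff[of "(real n - k) / M" 1] less_le_trans[OF exp_gt_zero] by blast
    then show ?thesis using l M by (simp add: u_def ln_div M_def)
  qed
  have g_anti: "g t \<le> g r" if "r \<le> t" for r t
  proof -
    have "exp (r - 2) \<le> exp (t - 2)" using that by simp
    then show ?thesis unfolding g_def by (intro max.mono order_refl) linarith
  qed
  have g_nonneg: "0 \<le> g t" for t by (simp add: g_def)
  have h_nonneg: "0 \<le> h t" if "0 \<le> t" for t
    using that k unfolding h_def by (intro mult_nonneg_nonneg g_nonneg pois_cdf_nonneg) auto
  have h_anti: "h t \<le> h r" if "0 \<le> r" "r \<le> t" for r t
    using that k unfolding h_def
    by (intro mult_mono g_anti pois_cdf_antimono mult_left_mono mult_nonneg_nonneg g_nonneg pois_cdf_nonneg) auto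
  have h_cont: "continuous_on A h" for A
    unfolding h_def g_def
    by (intro continuous_intros continuous_on_compose2[OF continuous_on_pois_cdf[of UNIV]]) auto
  have "1 / exp 1 - (k + 1) / n \<le> M / n"
    using l n by (simp add: M_def field_simps)
  then have "(1 / exp 1 - (k + 1) / n) * integral {0..1} h \<le> M / n * integral {0..1} h"
    by (intro mult_right_mono integral_nonneg integrable_continuous_real h_cont h_nonneg) auto
  also have "integral {0..1} h \<le> integral {0..u (Suc n)} h"
    using \<open>1 \<le> u (Suc n)\<close>
    by (intro integral_subset_le integrable_continuous_real h_cont) (auto intro: h_nonneg)
  then have "M / n * integral {0..1} h \<le> M / n * integral {0..u (Suc n)} h"
    using M n by (intro mult_left_mono) auto
  also have "integral {0..u (Suc n)} h \<le> (\<Sum>i=l..<Suc n. h (u i) * (u (Suc i) - u i))"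
    using integral_le_left_sum[of l "Suc n" u h] mono_u l h_cont h_anti
    by (simp add: u_l monotone_on_def del: sum.op_ivl_Suc)
  then have "M / n * integral {0..u (Suc n)} h \<le> M / n * (\<Sum>i=l..<Suc n. h (u i) * (u (Suc i) - u i))"
    using M n by (intro mult_left_mono) auto
  also have "\<dots> = (\<Sum>i=l..n. M / n * (h (u i) * (u (Suc i) - u i)))"
    by (simp add: sum_distrib_left atLeastLessThanSuc_atLeastAtMost del: sum.op_ivl_Suc)
  also have "\<dots> \<le> (\<Sum>i=l..n. (real l - 1) * (s i * pois_cdf k ((real k - 1) * u i)))"
  proof (rule sum_mono)
    fix i assume i: "i \<in> {l..n}"
    define z where "z = real i - k - 1"
    have z: "z \<ge> M" using i by (simp add: z_def M_def)
    \<comment> \<open>Since z = M exp (u i) and M <= n / e, i / n is at most exp (u i - 1) + (k + 1)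
      / n. The truncated case holds because e > 2 and k >= 2 make the right side
      nonnegative.\<close>
    have gi: "g (u i) \<le> 1 - real i / n / exp 1 - 1 / (exp 1 * k)"
    proof -
      have "exp (u i) = z / M" using z M by (simp add: u_def exp_diff z_def)
      then have z_eq: "z = M * exp (u i)" using M by simp
      have "M \<le> n / exp 1" using l by (simp add: M_def)
      then have "M * exp (u i) \<le> n / exp 1 * exp (u i)" by (rule mult_right_mono) simp
      then have "real i \<le> n / exp 1 * exp (u i) + (k + 1)" using z_eq by (simp add: z_def)
      then have "real i / n / exp 1 \<le> (n / exp 1 * exp (u i) + (k + 1)) / n / exp 1"
        using n by (intro divide_right_mono) auto
      also have "\<dots> = exp (u i - 2) + (k + 1) / n / exp 1"
      proof -
        have "exp (2::real) = exp 1 * exp 1" by (simp flip: exp_add)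
        then show ?thesis using n by (simp add: exp_diff field_simps)
      qed
      also have "(k + 1) / n / exp 1 \<le> (k + 1) / n"
        using n by (intro divide_left_mono[of 1 "exp 1", THEN order_trans]) auto
      finally have 1: "1 - exp (u i - 2) - 1 / (exp 1 * k) - (k + 1) / n \<le> 1 - real i / n / exp 1 - 1 / (exp 1 * k)"
        by simp
      have "real i / n \<le> 1" using i n by simp
      then have "real i / n / exp 1 \<le> 1 / 2"
        using exp1_gt_2 by (intro frac_le) simp_all
      moreover have "1 / (exp 1 * real k) \<le> 1 / (2 * 2)"
        using exp1_gt_2 k by (intro divide_left_mono mult_mono) auto
      ultimately show ?thesis using 1 by (simp add: g_def)
    qed
    have "u (Suc i) - u i = ln ((z + 1) / z)"
      using z M by (simp add: u_def z_def ln_div)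
    also have "\<dots> \<le> 1 / z" using ln_le_minus_one[of "(z + 1) / z"] z M by (simp add: field_simps)
    finally have "M * (u (Suc i) - u i) \<le> M * (1 / z)" using M by (intro mult_left_mono) simp_all
    also have "\<dots> \<le> (real l - 1) / (real i - 1)"
    proof -
      \<comment> \<open>After cross-multiplication the two sides differ by k (i - l).\<close>
      have "real k * real l \<le> real k * real i" using i by (intro mult_left_mono) simp_all
      then have "M * (real i - 1) \<le> (real l - 1) * z" by (simp add: M_def z_def algebra_simps)
      moreover have "0 < real i - 1" "0 < z" using z M i l by auto
      ultimately show ?thesis by (simp add: divide_simps)
    qed
    finally have "M * (u (Suc i) - u i) * g (u i) \<le> (real l - 1) / (real i - 1) * (1 - real i / n / exp 1 - 1 / (exp 1 * k))"
      using gi g_nonneg l i by (intro mult_mono) auto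
    then have "M * (u (Suc i) - u i) * g (u i) * (pois_cdf k ((real k - 1) * u i) / n)
        \<le> (real l - 1) / (real i - 1) * (1 - real i / n / exp 1 - 1 / (exp 1 * k)) * (pois_cdf k ((real k - 1) * u i) / n)"
      using pois_cdf_nonneg[of "(real k - 1) * u i" k] u_nonneg[of i] i k n by (intro mult_right_mono) auto
    then show "M / n * (h (u i) * (u (Suc i) - u i)) \<le> (real l - 1) * (s i * pois_cdf k ((real k - 1) * u i))"
      by (simp add: h_def s_def mult_ac)
  qed
  finally show ?thesis
    unfolding sum_distrib_left h_def[abs_def] g_def u_def M_def .
qed

text \<open>Chebyshev's inequality separates the factors, and subtracting \<open>\<delta>\<close>
  costs at most \<open>\<delta>\<close> as the Poisson factor is at most 1. In \<open>c\<close>, the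
  mean of exp (t - 2) is replaced by that of its chord, (1/e + 1/e^2) / 2.\<close>

lemma integral_lower_bound:
  fixes k :: nat and \<delta> :: real
  assumes k: "k \<ge> 2" and \<delta>: "0 \<le> \<delta>"
  defines "c \<equiv> 1 - (1 / exp 1 + 1 / exp 1 ^ 2) / 2 - 1 / (exp 1 * k)"
    and "J \<equiv> 1 - sqrt (real k - 1) / ((real k + 1) * sqrt (2 * pi))"
  shows "c * J - \<delta> \<le> integral {0..1} (\<lambda>t. max 0 (1 - exp (t - 2) - 1 / (exp 1 * k) - \<delta>) * pois_cdf k ((real k - 1) * t))"
    and "0 \<le> c * J" "c * J \<le> 1"
proof -
  define g where "g t = 1 - exp (t - 2) - 1 / (exp 1 * k)" for t :: real
  define p where "p t = pois_cdf k ((real k - 1) * t)" for t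
  have e: "exp (1::real) > 2" by (rule exp1_gt_2)
  have "exp (2::real) = exp 1 ^ 2" by (simp add: exp_of_nat_mult[symmetric])
  have k_eq: "k = Suc (k - 1)" "real (k - 1) = real k - 1" using k by auto
  define a b d where "a = 1 / exp (1::real)" and "b = 1 / exp (1::real) ^ 2" and "d = 1 / (exp 1 * real k)"
  note abd = a_def b_def d_def
  have c_eq: "c = 1 - a / 2 - b / 2 - d" by (simp add: c_def abd add_divide_distrib)
  have "a \<le> 1 / 2" unfolding abd using e by (intro frac_le) auto
  moreover have "b \<le> 1 / 4" unfolding abd
    using power_mono[of 2 "exp 1 :: real" 2] e by (intro frac_le) auto
  moreover have "d \<le> 1 / (2 * 2)" unfolding abd using e k by (intro frac_le mult_mono) auto
  moreover have "0 \<le> a" "0 \<le> b" "0 \<le> d" by (simp_all add: abd)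
  ultimately have c: "0 \<le> c" "c \<le> 1" unfolding c_eq by simp_all
  have J: "0 \<le> J" "J \<le> 1"
  proof -
    have "sqrt (real k - 1) \<le> sqrt ((real k + 1)\<^sup>2)"
      using k by (intro real_sqrt_le_mono) (simp add: power2_eq_square algebra_simps)
    then have "sqrt (real k - 1) \<le> (real k + 1) * 1" by simp
    also have "\<dots> \<le> (real k + 1) * sqrt (2 * pi)"
      using pi_ge_two by (intro mult_left_mono) auto
    finally have "sqrt (real k - 1) / ((real k + 1) * sqrt (2 * pi)) \<le> 1"
      by (simp add: divide_le_eq_1)
    then show "0 \<le> J" by (simp add: J_def)
    show "J \<le> 1" using k by (simp add: J_def)
  qed
  show "0 \<le> c * J" "c * J \<le> 1" using c J by (auto intro: mult_le_one)
  have p01: "0 \<le> p t" "p t \<le> 1" if "0 \<le> t" for t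
    using that k pois_cdf_nonneg[of "(real k - 1) * t"] pois_cdf_le_1[of "(real k - 1) * t"] by (simp_all add: p_def)
  have cont: "continuous_on A g" "continuous_on A p" for A
    unfolding g_def p_def using k
    by (auto intro!: continuous_intros continuous_on_compose2[OF continuous_on_pois_cdf[of UNIV]])
  have anti: "antimono_on {0..1} g" "antimono_on {0..1} p"
  proof -
    show "antimono_on {0..1} g" by (rule monotone_onI) (simp add: g_def)
    have "p t \<le> p r" if "0 \<le> r" "r \<le> t" for r t
      unfolding p_def using that k by (intro pois_cdf_antimono mult_left_mono mult_nonneg_nonneg) auto
    then show "antimono_on {0..1} p" by (intro monotone_onI) auto
  qed
  have int_g: "integral {0..1} g = 1 - (a - b) - d"
  proof -
    have "((\<lambda>t. t - exp (t - 2) - t / (exp 1 * k)) has_real_derivative g t) (at t within {0..1})" for t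
      unfolding g_def using k by (auto intro!: derivative_eq_intros)
    then have "(g has_integral ((1 - exp (1 - 2) - 1 / (exp 1 * k)) - (0 - exp (0 - 2) - 0 / (exp 1 * k)))) {0..1}"
      by (intro fundamental_theorem_of_calculus) (simp_all add: has_real_derivative_iff_has_vector_derivative)
    then have "integral {0..1} g = 1 - exp (1 - 2) - 1 / (exp 1 * k) + exp (- 2)"
      by (simp add: integral_unique)
    also have "exp (1 - 2) = 1 / exp (1::real)" by (simp add: exp_minus inverse_eq_divide)
    also have "exp (- 2) = 1 / exp (1::real) ^ 2"
      using \<open>exp 2 = exp 1 ^ 2\<close> by (simp add: exp_minus inverse_eq_divide)
    finally show ?thesis by (simp add: abd)
  qed
  \<comment> \<open>This comparison amounts to e <= 3.\<close>
  have "c \<le> integral {0..1} g"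
  proof -
    have "exp 1 * b \<le> 3 * b"
      using exp_le \<open>0 \<le> b\<close> by (intro mult_right_mono) auto
    moreover have "exp 1 * b = a" by (simp add: abd power2_eq_square)
    ultimately show ?thesis unfolding int_g c_eq by simp
  qed
  moreover have "J \<le> integral {0..1} p"
    using pois_cdf_integral[of "k - 1"] k k_eq(1)[symmetric] unfolding p_def J_def k_eq(2) by (simp add: add.commute)
  ultimately have "c * J \<le> integral {0..1} g * integral {0..1} p"
    using c J by (intro mult_mono) auto
  also have "\<dots> \<le> integral {0..1} (\<lambda>t. g t * p t)"
    by (intro integral_Chebyshev cont anti)
  finally have "c * J - \<delta> \<le> integral {0..1} (\<lambda>t. g t * p t) - \<delta>" by simp
  also have "\<dots> = integral {0..1} (\<lambda>t. g t * p t - \<delta>)"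
    using has_integral_diff[OF integrable_integral has_integral_const_real[of \<delta> 0 1], of "\<lambda>t. g t * p t"]
    by (simp add: integral_unique integrable_continuous_real continuous_on_mult cont)
  also have "\<dots> \<le> integral {0..1} (\<lambda>t. max 0 (g t - \<delta>) * p t)"
  proof (intro integral_le integrable_continuous_real continuous_intros cont)
    fix t :: real assume "t \<in> {0..1}"
    then have "0 \<le> p t" "p t \<le> 1" using p01 by auto
    then have "\<delta> * p t \<le> \<delta> * 1" using \<delta> by (intro mult_left_mono)
    then have "g t * p t - \<delta> \<le> (g t - \<delta>) * p t" by (simp add: left_diff_distrib)
    also have "\<dots> \<le> max 0 (g t - \<delta>) * p t" using \<open>0 \<le> p t\<close> by (intro mult_right_mono) auto
    finally show "g t * p t - \<delta> \<le> max 0 (g t - \<delta>) * p t" .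
  qed
  finally show "c * J - \<delta> \<le> integral {0..1} (\<lambda>t. max 0 (1 - exp (t - 2) - 1 / (exp 1 * k) - \<delta>) * pois_cdf k ((real k - 1) * t))"
    by (simp add: g_def p_def)
qed

section \<open>The competitive ratio\<close>

text \<open>The numerator contains the factor e - 1; cancelling it leaves the constant
  \<open>c\<close> of the integral bound divided by e.\<close>

lemma competitive_ratio_eq:
  fixes k :: real
  assumes "k > 0"
  shows "(1 + 1 / (2 * exp 1 ^ 3) - 3 / (2 * exp 1) - (exp 1 - 1) / (exp 1 ^ 2 * k)) / (exp 1 - 1)
    = (1 - (1 / exp 1 + 1 / exp 1 ^ 2) / 2 - 1 / (exp 1 * k)) / exp 1"
proof -
  have "(1 + 1 / (2 * e ^ 3) - 3 / (2 * e) - (e - 1) / (e ^ 2 * k)) / (e - 1)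
    = (1 - (1 / e + 1 / e ^ 2) / 2 - 1 / (e * k)) / e" if "e > 1" for e :: real
  proof -
    have "e - 1 \<noteq> 0" "e \<noteq> 0" using that by auto
    have "1 + 1 / (2 * e ^ 3) - 3 / (2 * e) - (e - 1) / (e ^ 2 * k)
      = (e - 1) * ((1 - (1 / e + 1 / e ^ 2) / 2 - 1 / (e * k)) / e)"
      using that assms by (simp add: field_simps power2_eq_square power3_eq_cube)
    then show ?thesis using \<open>e - 1 \<noteq> 0\<close> by simp
  qed
  then show ?thesis using exp1_gt_2 by simp
qed

lemma (in submodular_secretary) opt_value_attained:
  obtains Q where "Q \<subseteq> U" "card Q \<le> k" "v Q = opt_value U v k"
proof -
  have "finite {v S | S. S \<subseteq> U \<and> card S \<le> k}"
    using finU by (auto intro: finite_subset[of _ "v ` Pow U"])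
  moreover have "{v S | S. S \<subseteq> U \<and> card S \<le> k} \<noteq> {}"
    by (auto intro: exI[of _ "{}"])
  ultimately have "opt_value U v k \<in> {v S | S. S \<subseteq> U \<and> card S \<le> k}"
    unfolding opt_value_def by (rule Max_in)
  then obtain S where "opt_value U v k = v S" "S \<subseteq> U" "card S \<le> k" by auto
  then show ?thesis by (intro that[of S]) simp_all
qed

text \<open>The explicit o(1) term: the error (k + 1) / n enters twice, in the prefactor 1/e and in
  the integrand.\<close>

lemma (in submodular_secretary) expected_alg1_ge:
  assumes k: "k \<ge> 2" and n: "card U \<ge> 3 * (k + 3)"
  shows "((1 - (1 / exp 1 + 1 / exp 1 ^ 2) / 2 - 1 / (exp 1 * k)) / exp 1
        * (1 - sqrt (real k - 1) / ((real k + 1) * sqrt (2 * pi)))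
        - 2 * (real k + 1) / card U) * opt_value U v k
    \<le> expected_alg1 (1 / exp 1) U v tb k"
proof -
  define n where "n = card U"
  define \<delta> where "\<delta> = real (k + 1) / n"
  define l where "l = max 1 (nat \<lceil>1 / exp 1 * real n\<rceil>)"
  define c where "c = 1 - (1 / exp 1 + 1 / exp 1 ^ 2) / 2 - 1 / (exp 1 * k)"
  define J where "J = 1 - sqrt (real k - 1) / ((real k + 1) * sqrt (2 * pi))"
  define I where "I = integral {0..1} (\<lambda>t. max 0 (1 - exp (t - 2) - 1 / (exp 1 * k) - real (k + 1) / n) * pois_cdf k ((real k - 1) * t))"
  obtain Q where Q: "Q \<subseteq> U" "card Q \<le> k" "v Q = opt_value U v k"
    by (rule opt_value_attained)
  have n3: "real n \<ge> 3 * (real k + 3)" using n by (simp add: n_def)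
  define x where "x = real n / exp 1"
  \<comment> \<open>As e <= 3, the size assumption gives n / e >= k + 3, which yields both l >= k +
    2 and \<open>\<delta> \<le> 1 / exp 1\<close>.\<close>
  have "real n / 3 \<le> x" unfolding x_def using exp_le by (intro divide_left_mono) auto
  then have ne: "real k + 3 \<le> x" using n3 by simp
  have l_eq: "l = nat \<lceil>x\<rceil>" using ne by (simp add: l_def x_def max_def) linarith
  have lx: "x \<le> real l" "real l - 1 \<le> x"
    unfolding l_eq using ne by linarith+
  have lk: "k + 2 \<le> l" using lx(1) ne by linarith
  have ln: "l \<le> n"
  proof -
    have "x \<le> real n / 2" unfolding x_def using exp1_gt_2 by (intro divide_left_mono) auto
    then have "real l \<le> real n" using lx(2) n3 by simp
    then show ?thesis by simp
  qed
  have \<delta>: "0 \<le> \<delta>" "\<delta> \<le> 1 / exp 1"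
  proof -
    show "0 \<le> \<delta>" by (simp add: \<delta>_def)
    have "real (k + 1) \<le> real n / exp 1" using ne by (simp add: x_def)
    then have "\<delta> \<le> real n / exp 1 / n" unfolding \<delta>_def by (intro divide_right_mono) auto
    then show "\<delta> \<le> 1 / exp 1" using n3 by simp
  qed
  have cJ: "0 \<le> c * J" "c * J \<le> 1" and I: "c * J - \<delta> \<le> I"
    using integral_lower_bound[OF k \<delta>(1)] unfolding c_def J_def I_def \<delta>_def by simp_all
  \<comment> \<open>Each cross term of the product costs at most \<open>\<delta>\<close>, because
    \<open>c * J\<close> and 1/e are at most 1.\<close>
  have "c * J / exp 1 - 2 * \<delta> \<le> (1 / exp 1 - \<delta>) * (c * J - \<delta>)"
  proof -
    have "\<delta> * (c * J) \<le> \<delta> * 1" using cJ \<delta> by (intro mult_left_mono) auto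
    moreover have "\<delta> * (1 / exp 1) \<le> \<delta> * 1" using \<delta> by (intro mult_left_mono) auto
    moreover have "0 \<le> \<delta> * \<delta>" by simp
    moreover have "(1 / exp 1 - \<delta>) * (c * J - \<delta>) = c * J / exp 1 - \<delta> * (c * J) - \<delta> * (1 / exp 1) + \<delta> * \<delta>"
      by (simp add: algebra_simps)
    ultimately show ?thesis by linarith
  qed
  also have "\<dots> \<le> (1 / exp 1 - \<delta>) * I"
    using I \<delta> by (intro mult_left_mono) auto
  finally have "(c * J / exp 1 - 2 * \<delta>) * v Q \<le> (1 / exp 1 - \<delta>) * I * v Q"
    using v_nonneg[OF Q(1)] by (rule mult_right_mono)
  also have "\<dots> \<le> remaining_value l k"
    unfolding \<delta>_def I_def
    using mult_right_mono[OF sum_ge_integral[OF k lk ln lx[unfolded x_def]] v_nonneg[OF Q(1)]]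
      remaining_value_ge_sum[OF k Q(1,2) lk, of k] ln
    unfolding n_def by simp
  also have "\<dots> = expected_alg1 (1 / exp 1) U v tb k"
    by (simp add: expected_alg1_eq_remaining_value l_def n_def)
  finally have "(c / exp 1 * J - 2 * \<delta>) * v Q \<le> expected_alg1 (1 / exp 1) U v tb k" by simp
  moreover have "2 * \<delta> = 2 * (real k + 1) / card U" by (simp add: \<delta>_def n_def)
  ultimately show ?thesis unfolding Q(3) c_def J_def by simp
qed

theorem mainTheorem6:
  fixes k :: nat
  assumes "k \<ge> 2"
  shows "\<forall>\<epsilon>>0. \<exists>N. \<forall>(U :: 'a set) v tb.
           finite U \<and> card U \<ge> N \<and> nonneg_setfun U v \<and> monotone_setfun U v
           \<and> submodular_setfun U v \<and> tie_rule tb \<longrightarrow>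
           expected_alg1 (1 / exp 1) U v tb k \<ge>
             ((1 + 1 / (2 * exp 1 ^ 3) - 3 / (2 * exp 1) - (exp 1 - 1) / (exp 1 ^ 2 * real k))
                / (exp 1 - 1)
              * (1 - sqrt (real k - 1) / ((real k + 1) * sqrt (2 * pi)))
              - \<epsilon>) * opt_value U v k"
proof (intro allI impI)
  fix \<epsilon> :: real assume \<epsilon>: "\<epsilon> > 0"
  \<comment> \<open>The first bound makes the explicit estimate available, the second pushes its
    error term below \<open>\<epsilon>\<close>.\<close>
  define N where "N = max (3 * (k + 3)) (nat \<lceil>2 * (real k + 1) / \<epsilon>\<rceil>)"
  show "\<exists>N. \<forall>(U :: 'a set) v tb.
           finite U \<and> card U \<ge> N \<and> nonneg_setfun U v \<and> monotone_setfun U v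
           \<and> submodular_setfun U v \<and> tie_rule tb \<longrightarrow>
           expected_alg1 (1 / exp 1) U v tb k \<ge>
             ((1 + 1 / (2 * exp 1 ^ 3) - 3 / (2 * exp 1) - (exp 1 - 1) / (exp 1 ^ 2 * real k))
                / (exp 1 - 1)
              * (1 - sqrt (real k - 1) / ((real k + 1) * sqrt (2 * pi)))
              - \<epsilon>) * opt_value U v k"
  proof (intro exI[of _ N] allI impI)
    fix U :: "'a set" and v and tb :: "'a set \<Rightarrow> 'a"
    assume *: "finite U \<and> card U \<ge> N \<and> nonneg_setfun U v \<and> monotone_setfun U v
           \<and> submodular_setfun U v \<and> tie_rule tb"
    interpret submodular_secretary U v tb k
      using * assms by unfold_locales auto
    have big: "card U \<ge> 3 * (k + 3)" "card U \<ge> nat \<lceil>2 * (real k + 1) / \<epsilon>\<rceil>" using * by (auto simp: N_def)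
    have "2 * (real k + 1) / \<epsilon> \<le> card U" using big(2) by linarith
    then have "2 * (real k + 1) / card U \<le> \<epsilon>"
      using \<epsilon> big(1) by (simp add: divide_le_eq mult.commute)
    moreover obtain Q where "Q \<subseteq> U" "v Q = opt_value U v k" by (rule opt_value_attained)
    then have "0 \<le> opt_value U v k" using v_nonneg by metis
    ultimately have "(a - \<epsilon>) * opt_value U v k \<le> (a - 2 * (real k + 1) / card U) * opt_value U v k" for a
      by (intro mult_right_mono) auto
    from order_trans[OF this expected_alg1_ge[OF assms big(1)]]
    show "expected_alg1 (1 / exp 1) U v tb k \<ge>
             ((1 + 1 / (2 * exp 1 ^ 3) - 3 / (2 * exp 1) - (exp 1 - 1) / (exp 1 ^ 2 * real k))
                / (exp 1 - 1)
              * (1 - sqrt (real k - 1) / ((real k + 1) * sqrt (2 * pi)))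
              - \<epsilon>) * opt_value U v k"
      using competitive_ratio_eq[of "real k"] assms by simp
  qed
qed


end
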